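(* Let $p\in[1,\infty)$ and $0<a<b$. Then (i) $\mathfrak{L}^p_b\subset\mathfrak{L}^p_a\subset L^p(\mathbb{R}^d)$ and the inclusions are continuous; (ii) $\mathfrak{L}^p_a$ and $\mathfrak{L}^p_b$ are isometrically isomorphic.
   Context: $H=-\Delta+|x|^2$ on $\mathbb{R}^d$. For $s>0$, $H^{-s}$ is the operator on $L^p(\mathbb{R}^d)$ given by $H^{-s}f(x)=\int K_s(x,y)f(y)\,dy$, $K_s(x,y)=\frac{1}{\Gamma(s)}\int_0^\infty G_t(x,y)t^{s-1}dt$, $G_t(x,y)=(2\pi\sinh 2t)^{-d/2}\exp(-\frac12|x-y|^2\coth 2t-x\cdot y\tanh t)$; it satisfies $H^{-s}h_\alpha=(2|\alpha|+d)^{-s}h_\alpha$ on Hermite functions $h_\alpha$ and is one-to-one. For $p\in[1,\infty)$ and $a>0$, the Hermite potential space is $\mathfrak{L}^p_a=H^{-a/2}(L^p(\mathbb{R}^d))$ with norm $\|f\|_{\mathfrak{L}^p_a}=\|g\|_p$, where $g\in L^p$ is the unique function with $H^{-a/2}g=f$. *)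

theory Defs
  imports "HOL-Analysis.Analysis"
begin

text \<open>
  \<open>\<real>\<^sup>d\<close> is a Euclidean space \<open>'a\<close> with \<open>d = DIM('a)\<close>. The only Euclidean spaces in
  \<^class>\<open>real_normed_field\<close> are (copies of) the real and the complex numbers, so \<open>'k\<close> covers
  real-valued and complex-valued functions simultaneously. Elements of the function spaces are
  classes of Borel functions modulo equality almost everywhere; every Lebesgue measurable
  function agrees almost everywhere with a Borel one.
\<close>

definition ae_rel ::
  "('a::euclidean_space \<Rightarrow> 'k::{real_normed_field, euclidean_space}) \<Rightarrow> ('a \<Rightarrow> 'k) \<Rightarrow> bool" where
  "ae_rel f g \<longleftrightarrow> f \<in> borel_measurable lborel \<and> g \<in> borel_measurable lborel \<and>
                 (AE x in lborel. f x = g x)"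

lemma part_equivp_ae_rel:
  "part_equivp (ae_rel :: ('a::euclidean_space \<Rightarrow> 'k::{real_normed_field, euclidean_space}) \<Rightarrow> _)"
proof (rule part_equivpI)
  show "\<exists>f :: 'a \<Rightarrow> 'k. ae_rel f f"
    by (intro exI[of _ "\<lambda>_. 0"]) (simp add: ae_rel_def)
  show "symp (ae_rel :: ('a \<Rightarrow> 'k) \<Rightarrow> _)"
    by (auto simp: symp_def ae_rel_def eq_commute)
  show "transp (ae_rel :: ('a \<Rightarrow> 'k) \<Rightarrow> _)"
  proof (rule transpI)
    fix f g h :: "'a \<Rightarrow> 'k"
    assume "ae_rel f g" "ae_rel g h"
    moreover from this have "AE x in lborel. f x = g x" "AE x in lborel. g x = h x"
      by (simp_all add: ae_rel_def)
    then have "AE x in lborel. f x = h x" by eventually_elim simp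
    ultimately show "ae_rel f h" by (simp add: ae_rel_def)
  qed
qed

quotient_type (overloaded) ('a, 'k) ae_fun =
  "'a::euclidean_space \<Rightarrow> 'k::{real_normed_field, euclidean_space}" / partial: ae_rel
  by (rule part_equivp_ae_rel)

instantiation ae_fun :: (euclidean_space, "{real_normed_field, euclidean_space}") ab_group_add
begin

lift_definition zero_ae_fun :: "('a, 'b) ae_fun" is "\<lambda>_. 0"
  by (simp add: ae_rel_def)

lift_definition plus_ae_fun :: "('a, 'b) ae_fun \<Rightarrow> ('a, 'b) ae_fun \<Rightarrow> ('a, 'b) ae_fun"
  is "\<lambda>f g x. f x + g x"
  unfolding ae_rel_def by auto

lift_definition minus_ae_fun :: "('a, 'b) ae_fun \<Rightarrow> ('a, 'b) ae_fun \<Rightarrow> ('a, 'b) ae_fun"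
  is "\<lambda>f g x. f x - g x"
  unfolding ae_rel_def by auto

lift_definition uminus_ae_fun :: "('a, 'b) ae_fun \<Rightarrow> ('a, 'b) ae_fun"
  is "\<lambda>f x. - f x"
  unfolding ae_rel_def by auto

instance
  by standard (transfer; auto simp: ae_rel_def algebra_simps)+

end

lift_definition scale_ae ::
  "'k \<Rightarrow> ('a::euclidean_space, 'k::{real_normed_field, euclidean_space}) ae_fun \<Rightarrow> ('a, 'k) ae_fun"
  is "\<lambda>c f x. c * f x"
  unfolding ae_rel_def by auto

lift_definition in_Lp ::
  "real \<Rightarrow> ('a::euclidean_space, 'k::{real_normed_field, euclidean_space}) ae_fun \<Rightarrow> bool"
  is "\<lambda>p f. integrable lborel (\<lambda>x. norm (f x) powr p)"
  unfolding ae_rel_def by (intro integrable_cong_AE) auto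

definition Lp ::
  "real \<Rightarrow> ('a::euclidean_space, 'k::{real_normed_field, euclidean_space}) ae_fun set" where
  "Lp p = {f. in_Lp p f}"

lift_definition Lp_norm ::
  "real \<Rightarrow> ('a::euclidean_space, 'k::{real_normed_field, euclidean_space}) ae_fun \<Rightarrow> real"
  is "\<lambda>p f. (LINT x|lborel. norm (f x) powr p) powr (1 / p)"
  unfolding ae_rel_def by (intro arg_cong2[where f = "(powr)"] integral_cong_AE refl) auto

definition mehler_kernel :: "real \<Rightarrow> 'a::euclidean_space \<Rightarrow> 'a \<Rightarrow> real" where
  "mehler_kernel t x y =
     (2 * pi * sinh (2 * t)) powr (- real DIM('a) / 2) *
     exp (- (norm (x - y))\<^sup>2 / 2 * (cosh (2 * t) / sinh (2 * t)) - (x \<bullet> y) * tanh t)"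

text \<open>
  The integral below diverges at most on the diagonal \<open>x = y\<close>, which is null for every fixed \<open>x\<close>,
  so the default value of the integral there has no effect on \<open>hermite_power\<close>.
\<close>

definition potential_kernel :: "real \<Rightarrow> 'a::euclidean_space \<Rightarrow> 'a \<Rightarrow> real" where
  "potential_kernel s x y =
     1 / Gamma s * (LBINT t:{0<..}. mehler_kernel t x y * t powr (s - 1))"

lemma borel_measurable_potential_kernel:
  "(\<lambda>(x, y). potential_kernel s x y) \<in> borel_measurable (lborel \<Otimes>\<^sub>M (lborel :: 'a::euclidean_space measure))"
proof -
  have [measurable]: "(sinh :: real \<Rightarrow> real) \<in> borel_measurable borel"
    "(cosh :: real \<Rightarrow> real) \<in> borel_measurable borel"
    "(tanh :: real \<Rightarrow> real) \<in> borel_measurable borel"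
    by (intro borel_measurable_continuous_onI continuous_intros; simp)+
  show ?thesis
    unfolding potential_kernel_def mehler_kernel_def set_lebesgue_integral_def case_prod_beta
    by measurable
qed

text \<open>The operator \<open>H\<^sup>-\<^sup>s\<close> for \<open>s > 0\<close>.\<close>

lift_definition hermite_power ::
  "real \<Rightarrow> ('a::euclidean_space, 'k::{real_normed_field, euclidean_space}) ae_fun \<Rightarrow> ('a, 'k) ae_fun"
  is "\<lambda>s f x. LINT y|lborel. potential_kernel s x y *\<^sub>R f y"
proof -
  fix s :: real and f g :: "'a \<Rightarrow> 'k"
  assume fg: "ae_rel f g"
  note [measurable] = borel_measurable_potential_kernel[of s, where 'a = 'a]
  have meas: "(\<lambda>x. LINT y|lborel. potential_kernel s x y *\<^sub>R h y) \<in> borel_measurable lborel"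
    if [measurable]: "h \<in> borel_measurable lborel" for h :: "'a \<Rightarrow> 'k"
    by measurable
  have [measurable]: "potential_kernel s x \<in> borel_measurable lborel" for x :: 'a
    by measurable
  have "(LINT y|lborel. potential_kernel s x y *\<^sub>R f y) =
        (LINT y|lborel. potential_kernel s x y *\<^sub>R g y)" for x
    using fg unfolding ae_rel_def by (intro integral_cong_AE) auto
  then show "ae_rel (\<lambda>x. LINT y|lborel. potential_kernel s x y *\<^sub>R f y)
                    (\<lambda>x. LINT y|lborel. potential_kernel s x y *\<^sub>R g y)"
    using fg meas unfolding ae_rel_def by auto
qed

definition hermite_potential ::
  "real \<Rightarrow> real \<Rightarrow> ('a::euclidean_space, 'k::{real_normed_field, euclidean_space}) ae_fun set" where
  "hermite_potential p a = hermite_power (a / 2) ` Lp p"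

definition hermite_potential_norm ::
  "real \<Rightarrow> real \<Rightarrow> ('a::euclidean_space, 'k::{real_normed_field, euclidean_space}) ae_fun \<Rightarrow> real" where
  "hermite_potential_norm p a f = Lp_norm p (THE g. g \<in> Lp p \<and> hermite_power (a / 2) g = f)"

text \<open>
  Below, a normed space is given by its carrier \<open>S\<close> and its norm \<open>N\<close>; the vector space operations
  are those of \<open>ae_fun\<close>.
\<close>

definition continuously_included ::
  "('a::euclidean_space, 'k::{real_normed_field, euclidean_space}) ae_fun set \<Rightarrow> (('a, 'k) ae_fun \<Rightarrow> real) \<Rightarrow>
   ('a, 'k) ae_fun set \<Rightarrow> (('a, 'k) ae_fun \<Rightarrow> real) \<Rightarrow> bool" where
  "continuously_included S N S' N' \<longleftrightarrow> S \<subseteq> S' \<and>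
     (\<forall>f\<in>S. \<forall>\<epsilon>>0. \<exists>\<delta>>0. \<forall>g\<in>S. N (g - f) < \<delta> \<longrightarrow> N' (g - f) < \<epsilon>)"

definition isometrically_isomorphic ::
  "('a::euclidean_space, 'k::{real_normed_field, euclidean_space}) ae_fun set \<Rightarrow> (('a, 'k) ae_fun \<Rightarrow> real) \<Rightarrow>
   ('a, 'k) ae_fun set \<Rightarrow> (('a, 'k) ae_fun \<Rightarrow> real) \<Rightarrow> bool" where
  "isometrically_isomorphic S N S' N' \<longleftrightarrow> (\<exists>T. bij_betw T S S' \<and>
     (\<forall>f\<in>S. \<forall>g\<in>S. T (f + g) = T f + T g) \<and>
     (\<forall>c. \<forall>f\<in>S. T (scale_ae c f) = scale_ae c (T f)) \<and>
     (\<forall>f\<in>S. N' (T f) = N f))"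

end

theory Submission
  imports Defs "HOL-Probability.Distributions"
begin

text \<open>
  The Mehler kernels form a semigroup with \<open>\<integral> G\<^sub>t(x,y) dy \<le> 2e\<^sup>-\<^sup>t\<close>. Integrating against
  \<open>t\<^sup>s\<^sup>-\<^sup>1/\<Gamma>(s)\<close> and using the Beta integral, the Schur test bounds \<open>H\<^sup>-\<^sup>s\<close> on \<open>L\<^sup>p\<close> and
  \<open>H\<^sup>-\<^sup>sH\<^sup>-\<^sup>r = H\<^sup>-\<^sup>(\<^sup>s\<^sup>+\<^sup>r\<^sup>)\<close> there. The inclusions follow from
  \<open>H\<^sup>-\<^sup>b\<^sup>/\<^sup>2 = H\<^sup>-\<^sup>a\<^sup>/\<^sup>2 H\<^sup>-\<^sup>(\<^sup>b\<^sup>-\<^sup>a\<^sup>)\<^sup>/\<^sup>2\<close>, and \<open>H\<^sup>-\<^sup>a\<^sup>/\<^sup>2g \<mapsto> H\<^sup>-\<^sup>b\<^sup>/\<^sup>2g\<close> is the isometric isomorphism.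

  Injectivity of all \<open>H\<^sup>-\<^sup>s\<close> reduces by the semigroup law to that of \<open>H\<^sup>-\<^sup>1 = \<integral>\<^sub>0\<^sup>\<infinity> G\<^sub>t dt\<close>. If
  \<open>H\<^sup>-\<^sup>1f = 0\<close>, pairing with \<open>G\<^sub>r\<psi>\<close> for a box indicator \<open>\<psi>\<close> shows that
  \<open>\<integral>\<^sub>r\<^sup>\<infinity> \<langle>f, G\<^sub>t\<psi>\<rangle> dt = 0\<close> for every \<open>r \<ge> 0\<close>. As \<open>\<langle>f, G\<^sub>t\<psi>\<rangle> \<rightarrow> \<langle>f, \<psi>\<rangle>\<close> when \<open>t \<rightarrow> 0\<close>, the
  integral of \<open>f\<close> over every box vanishes, hence \<open>f = 0\<close>.
\<close>

subsection \<open>Mehler kernel\<close>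

text \<open>Completing the square makes the integrand a constant multiple of the normal density with
  mean \<open>m / \<alpha>\<close> and variance \<open>1 / \<alpha>\<close>.\<close>

lemma nn_integral_exp_quadratic:
  fixes \<alpha> m :: real
  assumes "\<alpha> > 0"
  shows "(\<integral>\<^sup>+x. ennreal (exp (- \<alpha> / 2 * x\<^sup>2 + m * x)) \<partial>lborel) =
         ennreal (sqrt (2 * pi / \<alpha>) * exp (m\<^sup>2 / (2 * \<alpha>)))"
proof -
  have s: "(1 / sqrt \<alpha>)\<^sup>2 = 1 / \<alpha>" using assms by (simp add: power_divide)
  have "exp (- \<alpha> / 2 * x\<^sup>2 + m * x) =
      (sqrt (2 * pi / \<alpha>) * exp (m\<^sup>2 / (2 * \<alpha>))) * normal_density (m / \<alpha>) (1 / sqrt \<alpha>) x" for x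
  proof -
    have "- \<alpha> / 2 * x\<^sup>2 + m * x = m\<^sup>2 / (2 * \<alpha>) + (- (x - m / \<alpha>)\<^sup>2 / (2 * (1 / \<alpha>)))"
      using assms by (simp add: field_simps power2_eq_square)
    then have "exp (- \<alpha> / 2 * x\<^sup>2 + m * x) =
        exp (m\<^sup>2 / (2 * \<alpha>)) * exp (- (x - m / \<alpha>)\<^sup>2 / (2 * (1 / \<alpha>)))"
      by (simp only: exp_add)
    then show ?thesis
      using assms unfolding normal_density_def s by simp
  qed
  moreover have "(\<integral>\<^sup>+x. ennreal (normal_density (m / \<alpha>) (1 / sqrt \<alpha>) x) \<partial>lborel) = 1"
    using assms by (subst nn_integral_eq_integral) auto
  ultimately show ?thesis
    using assms by (simp add: ennreal_mult' nn_integral_cmult)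
qed

text \<open>The integrand is a product over the coordinates, so the integral is a product of
  one-dimensional ones.\<close>

lemma nn_integral_exp_quadratic_euclidean:
  fixes v :: "'a::euclidean_space"
  assumes "\<alpha> > 0"
  shows "(\<integral>\<^sup>+y. ennreal (exp (- \<alpha> / 2 * (norm y)\<^sup>2 + v \<bullet> y)) \<partial>lborel) =
         ennreal ((2 * pi / \<alpha>) powr (DIM('a) / 2) * exp ((norm v)\<^sup>2 / (2 * \<alpha>)))"
proof -
  have "(\<integral>\<^sup>+y. ennreal (exp (- \<alpha> / 2 * (norm y)\<^sup>2 + v \<bullet> y)) \<partial>lborel) =
        (\<integral>\<^sup>+y. (\<Prod>b\<in>Basis. ennreal (exp (- \<alpha> / 2 * (y \<bullet> b)\<^sup>2 + (v \<bullet> b) * (y \<bullet> b)))) \<partial>(lborel :: 'a measure))"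
  proof (intro nn_integral_cong)
    fix y :: 'a
    have "- \<alpha> / 2 * (norm y)\<^sup>2 + v \<bullet> y =
        (\<Sum>b\<in>Basis. - \<alpha> / 2 * (y \<bullet> b)\<^sup>2 + (v \<bullet> b) * (y \<bullet> b))"
      unfolding sum.distrib sum_distrib_left[symmetric]
      unfolding power2_norm_eq_inner
      by (simp only: euclidean_inner[of y y] euclidean_inner[of v y] power2_eq_square)
    then show "ennreal (exp (- \<alpha> / 2 * (norm y)\<^sup>2 + v \<bullet> y)) =
        (\<Prod>b\<in>Basis. ennreal (exp (- \<alpha> / 2 * (y \<bullet> b)\<^sup>2 + (v \<bullet> b) * (y \<bullet> b))))"
      by (simp only: prod_ennreal exp_ge_zero exp_sum finite_Basis)
  qed
  also have "\<dots> = (\<Prod>b\<in>Basis. (\<integral>\<^sup>+x. ennreal (exp (- \<alpha> / 2 * x\<^sup>2 + (v \<bullet> b) * x)) \<partial>lborel))"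
    by (rule nn_integral_lborel_prod) auto
  also have "\<dots> = (\<Prod>b\<in>Basis. ennreal (sqrt (2 * pi / \<alpha>) * exp ((v \<bullet> b)\<^sup>2 / (2 * \<alpha>))))"
    by (simp only: nn_integral_exp_quadratic[OF assms])
  also have "\<dots> = ennreal (\<Prod>b\<in>(Basis :: 'a set). sqrt (2 * pi / \<alpha>) * exp ((v \<bullet> b)\<^sup>2 / (2 * \<alpha>)))"
    using assms by (intro prod_ennreal) simp
  also have "(\<Prod>b\<in>(Basis :: 'a set). sqrt (2 * pi / \<alpha>) * exp ((v \<bullet> b)\<^sup>2 / (2 * \<alpha>))) =
      sqrt (2 * pi / \<alpha>) ^ DIM('a) * exp (\<Sum>b\<in>Basis. (v \<bullet> b)\<^sup>2 / (2 * \<alpha>))"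
    by (simp add: prod.distrib exp_sum)
  also have "(\<Sum>b\<in>Basis. (v \<bullet> b)\<^sup>2 / (2 * \<alpha>)) = (norm v)\<^sup>2 / (2 * \<alpha>)"
    unfolding power2_norm_eq_inner
    by (simp only: euclidean_inner[of v v] sum_divide_distrib power2_eq_square)
  also have "sqrt (2 * pi / \<alpha>) ^ DIM('a) = (2 * pi / \<alpha>) powr (DIM('a) / 2)"
    using assms by (simp add: powr_half_sqrt[symmetric] powr_powr powr_realpow[symmetric])
  finally show ?thesis .
qed

section \<open>Mass, ground state and semigroup law of the Mehler kernel\<close>

text \<open>Expanding the square leaves the coefficient coth 2t - tanh t of the inner product, which
  equals 1 / sinh 2t. In this form the kernel is visibly a Gaussian in \<open>y\<close>.\<close>

lemma mehler_kernel_eq: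
  fixes x y :: "'a::euclidean_space"
  assumes "t > 0"
  shows "mehler_kernel t x y = (2 * pi * sinh (2 * t)) powr (- real DIM('a) / 2) *
    exp (- (cosh (2 * t) / sinh (2 * t)) / 2 * ((norm x)\<^sup>2 + (norm y)\<^sup>2) + x \<bullet> y / sinh (2 * t))"
proof -
  have S: "sinh t > 0" "cosh t > 0" using assms by auto
  have c: "cosh (2 * t) = 1 + 2 * (sinh t)\<^sup>2" 
    using cosh_square_eq[of t] by (simp add: cosh_double)
  have "- (norm (x - y))\<^sup>2 / 2 * (cosh (2 * t) / sinh (2 * t)) - (x \<bullet> y) * tanh t =
      - (cosh (2 * t) / sinh (2 * t)) / 2 * ((norm x)\<^sup>2 + (norm y)\<^sup>2) +
      x \<bullet> y * (cosh (2 * t) / sinh (2 * t) - tanh t)"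
    by (simp add: power2_norm_eq_inner algebra_simps inner_commute add_divide_distrib diff_divide_distrib)
  also have "cosh (2 * t) / sinh (2 * t) - tanh t = 1 / sinh (2 * t)"
    using S unfolding c sinh_double tanh_def by (simp add: divide_simps) (simp add: power2_eq_square)
  finally show ?thesis unfolding mehler_kernel_def by simp
qed

lemma mehler_kernel_nonneg [simp]: "0 \<le> mehler_kernel t x y"
  by (simp add: mehler_kernel_def)

lemma mehler_kernel_commute: "mehler_kernel t x y = mehler_kernel t y x"
  by (simp add: mehler_kernel_def norm_minus_commute inner_commute)

lemma borel_measurable_mehler_kernel [measurable (raw)]:
  assumes [measurable]: "f \<in> borel_measurable M" "g \<in> M \<rightarrow>\<^sub>M borel" "h \<in> M \<rightarrow>\<^sub>M borel"
  shows "(\<lambda>w. mehler_kernel (f w) (g w) (h w :: 'a::euclidean_space)) \<in> borel_measurable M"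
proof -
  have [measurable]: "(sinh :: real \<Rightarrow> real) \<in> borel_measurable borel"
    "(cosh :: real \<Rightarrow> real) \<in> borel_measurable borel"
    "(tanh :: real \<Rightarrow> real) \<in> borel_measurable borel"
    by (intro borel_measurable_continuous_onI continuous_intros; simp)+
  show ?thesis unfolding mehler_kernel_def by measurable
qed

text \<open>The product is again a Gaussian in \<open>y\<close>, with quadratic coefficient
  \<open>\<alpha>\<close> and linear part \<open>x /\<^sub>R sinh (2 * t) + v\<close>. The
  parameters cover three uses: total mass (\<open>\<beta>\<close> = 0), ground state
  (\<open>\<beta>\<close> = 1) and a second Mehler kernel (\<open>\<beta>\<close> = coth
  2r).\<close>

lemma nn_integral_mehler_kernel_gaussian:
  fixes x v :: "'a::euclidean_space"
  assumes t: "t > 0" and \<beta>: "\<beta> \<ge> 0"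
  defines "\<alpha> \<equiv> cosh (2 * t) / sinh (2 * t) + \<beta>"
  shows "(\<integral>\<^sup>+y. ennreal (mehler_kernel t x y * exp (- \<beta> / 2 * (norm y)\<^sup>2 + v \<bullet> y)) \<partial>lborel) =
    ennreal ((sinh (2 * t) * \<alpha>) powr (- real DIM('a) / 2) *
      exp (- (cosh (2 * t) / sinh (2 * t)) / 2 * (norm x)\<^sup>2 +
           (norm (x /\<^sub>R sinh (2 * t) + v))\<^sup>2 / (2 * \<alpha>)))"
proof -
  have S: "sinh (2 * t) > 0" using t by simp
  have \<alpha>: "\<alpha> > 0" unfolding \<alpha>_def using S \<beta> by (intro add_pos_nonneg divide_pos_pos) auto
  define c where "c = (2 * pi * sinh (2 * t)) powr (- real DIM('a) / 2) * exp (- (cosh (2 * t) / sinh (2 * t)) / 2 * (norm x)\<^sup>2)"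
  have "mehler_kernel t x y * exp (- \<beta> / 2 * (norm y)\<^sup>2 + v \<bullet> y) =
     c * exp (- \<alpha> / 2 * (norm y)\<^sup>2 + (x /\<^sub>R sinh (2 * t) + v) \<bullet> y)" for y
  proof -
    have "- q / 2 * (X + Y) + i / S + (- \<beta> / 2 * Y + j) = - q / 2 * X + (- (q + \<beta>) / 2 * Y + (i / S + j))"
      for q X Y i j S :: real
      by (simp add: field_simps)
    moreover have "(x /\<^sub>R sinh (2 * t) + v) \<bullet> y = x \<bullet> y / sinh (2 * t) + v \<bullet> y"
      by (simp add: inner_add_left divide_inverse_commute)
    ultimately show ?thesis
      unfolding mehler_kernel_eq[OF t] c_def \<alpha>_def mult.assoc exp_add[symmetric] by presburger
  qed
  then have "(\<integral>\<^sup>+y. ennreal (mehler_kernel t x y * exp (- \<beta> / 2 * (norm y)\<^sup>2 + v \<bullet> y)) \<partial>lborel) =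
     ennreal c * (\<integral>\<^sup>+y. ennreal (exp (- \<alpha> / 2 * (norm y)\<^sup>2 + (x /\<^sub>R sinh (2 * t) + v) \<bullet> y)) \<partial>lborel)"
    by (simp add: ennreal_mult' nn_integral_cmult c_def)
  also have "\<dots> = ennreal (c * ((2 * pi / \<alpha>) powr (DIM('a) / 2) * exp ((norm (x /\<^sub>R sinh (2 * t) + v))\<^sup>2 / (2 * \<alpha>))))"
    unfolding nn_integral_exp_quadratic_euclidean[OF \<alpha>]
    by (rule ennreal_mult'[symmetric]) (simp add: c_def)
  also have "c * ((2 * pi / \<alpha>) powr (DIM('a) / 2) * exp ((norm (x /\<^sub>R sinh (2 * t) + v))\<^sup>2 / (2 * \<alpha>))) =
     ((2 * pi * sinh (2 * t)) powr (- real DIM('a) / 2) * (2 * pi / \<alpha>) powr (DIM('a) / 2)) *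
     exp (- (cosh (2 * t) / sinh (2 * t)) / 2 * (norm x)\<^sup>2 +
           (norm (x /\<^sub>R sinh (2 * t) + v))\<^sup>2 / (2 * \<alpha>))"
    unfolding c_def exp_add by simp
  also have "(2 * pi * sinh (2 * t)) powr (- real DIM('a) / 2) * (2 * pi / \<alpha>) powr (DIM('a) / 2) =
      (sinh (2 * t) * \<alpha>) powr (- real DIM('a) / 2)"
    using S \<alpha> by (simp add: powr_mult powr_divide powr_minus field_simps)
  finally show ?thesis .
qed

text \<open>The exact mass is a power of cosh 2t times an exponential with nonpositive exponent. As
  the dimension is at least 1, the power is at most (cosh 2t)^(-1/2), and cosh 2t is at least half
  of exp(2t); the resulting factor sqrt 2 is rounded up to 2.\<close>

lemma nn_integral_mehler_kernel_le:
  fixes x :: "'a::euclidean_space"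
  assumes t: "t > 0"
  shows "(\<integral>\<^sup>+y. ennreal (mehler_kernel t x y) \<partial>lborel) \<le> ennreal (2 * exp (- t))"
proof -
  have S: "sinh (2 * t) > 0" using t by simp
  have C: "cosh (2 * t) \<ge> exp (2 * t) / 2" by (simp add: cosh_def)
  have "(\<integral>\<^sup>+y. ennreal (mehler_kernel t x y) \<partial>lborel) = ennreal (cosh (2 * t) powr (- real DIM('a) / 2) *
      exp (- (cosh (2 * t) / sinh (2 * t)) / 2 * (norm x)\<^sup>2 +
           (norm (x /\<^sub>R sinh (2 * t)))\<^sup>2 / (2 * (cosh (2 * t) / sinh (2 * t)))))"
    using nn_integral_mehler_kernel_gaussian[OF t order_refl, of x 0] S by simp
  also have "\<dots> \<le> ennreal (2 * exp (- t))"
  proof (intro ennreal_leI)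
    have "1 / (sinh (2 * t) * cosh (2 * t)) \<le> cosh (2 * t) / sinh (2 * t)"
    proof -
      have "1 / cosh (2 * t) \<le> cosh (2 * t)"
        using cosh_real_ge_1[of "2 * t"] by (smt (verit) divide_le_eq_1_pos)
      then have "1 / cosh (2 * t) / sinh (2 * t) \<le> cosh (2 * t) / sinh (2 * t)"
        using S by (intro divide_right_mono) auto
      then show ?thesis by (simp add: mult.commute)
    qed
    then have "(norm x)\<^sup>2 / 2 * (1 / (sinh (2 * t) * cosh (2 * t))) \<le> (norm x)\<^sup>2 / 2 * (cosh (2 * t) / sinh (2 * t))"
      by (intro mult_left_mono) auto
    moreover have "(norm (x /\<^sub>R sinh (2 * t)))\<^sup>2 / (2 * (cosh (2 * t) / sinh (2 * t))) =
        (norm x)\<^sup>2 / 2 * (1 / (sinh (2 * t) * cosh (2 * t)))"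
      using S by (simp add: field_simps power2_eq_square)
    ultimately have "exp (- (cosh (2 * t) / sinh (2 * t)) / 2 * (norm x)\<^sup>2 +
           (norm (x /\<^sub>R sinh (2 * t)))\<^sup>2 / (2 * (cosh (2 * t) / sinh (2 * t)))) \<le> exp 0"
      by (subst exp_le_cancel_iff) (simp add: mult.commute)
    moreover have "cosh (2 * t) powr (- real DIM('a) / 2) \<le> 2 * exp (- t)"
    proof -
      have "cosh (2 * t) powr (- real DIM('a) / 2) \<le> cosh (2 * t) powr (- 1 / 2)"
        using DIM_positive[where 'a = 'a] cosh_real_ge_1[of "2 * t"]
        by (intro powr_mono) (simp_all add: Suc_le_eq)
      also have "\<dots> \<le> (exp (2 * t) / 2) powr (- 1 / 2)"
        using C by (intro powr_mono2') auto
      also have "\<dots> = 2 powr (1 / 2) * exp (- t)"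
        by (simp add: powr_divide powr_minus powr_def exp_minus ln_div field_simps exp_diff flip: exp_add)
      also have "2 powr (1 / 2) * exp (- t) \<le> 2 powr 1 * exp (- t)"
        by (intro mult_right_mono powr_mono) auto
      finally show ?thesis by simp
    qed
    ultimately show "cosh (2 * t) powr (- real DIM('a) / 2) *
      exp (- (cosh (2 * t) / sinh (2 * t)) / 2 * (norm x)\<^sup>2 +
           (norm (x /\<^sub>R sinh (2 * t)))\<^sup>2 / (2 * (cosh (2 * t) / sinh (2 * t)))) \<le> 2 * exp (- t)"
      using mult_mono[of "cosh (2 * t) powr (- real DIM('a) / 2)" "2 * exp (- t)" _ 1] by simp
  qed
  finally show ?thesis .
qed

text \<open>The Gaussian is the lowest Hermite function up to normalization, with eigenvalue d of H.
  The case \<open>\<beta>\<close> = 1 applies, where \<open>\<alpha>\<close> simplifies to exp(2t) /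
  sinh 2t.\<close>

lemma nn_integral_mehler_kernel_ground_state:
  fixes x :: "'a::euclidean_space"
  assumes t: "t > 0"
  shows "(\<integral>\<^sup>+y. ennreal (mehler_kernel t x y * exp (- (norm y)\<^sup>2 / 2)) \<partial>lborel) =
    ennreal (exp (- real DIM('a) * t) * exp (- (norm x)\<^sup>2 / 2))"
proof -
  have S: "sinh (2 * t) > 0" using t by simp
  have E: "cosh (2 * t) + sinh (2 * t) = exp (2 * t)" by (rule cosh_plus_sinh)
  have E': "cosh (2 * t) - sinh (2 * t) = exp (- (2 * t))" by (rule cosh_minus_sinh)
  have \<alpha>: "cosh (2 * t) / sinh (2 * t) + 1 = exp (2 * t) / sinh (2 * t)"
    using S E by (simp add: field_simps)
  have "(norm (x /\<^sub>R sinh (2 * t)))\<^sup>2 / (2 * (exp (2 * t) / sinh (2 * t))) =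
     (norm x)\<^sup>2 / 2 * (exp (- (2 * t)) / sinh (2 * t))"
    using S by (simp add: field_simps power2_eq_square exp_minus)
  also have "\<dots> = (norm x)\<^sup>2 / 2 * (cosh (2 * t) / sinh (2 * t)) - (norm x)\<^sup>2 / 2"
    using S unfolding E'[symmetric] by (simp add: field_simps)
  finally have "- (cosh (2 * t) / sinh (2 * t)) / 2 * (norm x)\<^sup>2 +
           (norm (x /\<^sub>R sinh (2 * t)))\<^sup>2 / (2 * (exp (2 * t) / sinh (2 * t))) = - (norm x)\<^sup>2 / 2"
    by simp
  moreover have "exp (2 * t) powr (- real DIM('a) / 2) = exp (- real DIM('a) * t)"
    by (simp add: powr_def)
  ultimately show ?thesis
    using nn_integral_mehler_kernel_gaussian[OF t zero_le_one, of x 0] S unfolding \<alpha> by simp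
qed

text \<open>The semigroup law exp(-tH) exp(-rH) = exp(-(t+r)H) on kernels. As a function of
  \<open>z\<close> the second kernel is a Gaussian with quadratic coefficient coth 2r and linear
  part y / sinh 2r; the addition formulas for sinh and cosh identify the resulting Gaussian
  integral.\<close>

lemma nn_integral_mehler_kernel_mult:
  fixes x y :: "'a::euclidean_space"
  assumes t: "t > 0" and r: "r > 0"
  shows "(\<integral>\<^sup>+z. ennreal (mehler_kernel t x z) * ennreal (mehler_kernel r z y) \<partial>lborel) =
    ennreal (mehler_kernel (t + r) x y)"
proof -
  define S S' C C' U where "S = sinh (2 * t)" and "S' = sinh (2 * r)" and "C = cosh (2 * t)" and "C' = cosh (2 * r)"
    and "U = sinh (2 * (t + r))"
  have pos: "S > 0" "S' > 0" "U > 0" using t r by (auto simp: S_def S'_def U_def)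
  have U: "U = S * C' + C * S'" and CU: "cosh (2 * (t + r)) = C * C' + S * S'"
    unfolding U_def S_def S'_def C_def C'_def distrib_left by (simp_all add: sinh_add cosh_add)
  have sq: "C\<^sup>2 = 1 + S\<^sup>2" "C'\<^sup>2 = 1 + S'\<^sup>2"
    using cosh_square_eq[of "2 * t"] cosh_square_eq[of "2 * r"] by (simp_all add: S_def S'_def C_def C'_def)
  define k where "k = (2 * pi * S') powr (- real DIM('a) / 2) * exp (- (C' / S') / 2 * (norm y)\<^sup>2)"
  have k0: "k \<ge> 0" by (simp add: k_def)
  have "mehler_kernel t x z * mehler_kernel r z y =
    k * (mehler_kernel t x z * exp (- (C' / S') / 2 * (norm z)\<^sup>2 + (y /\<^sub>R S') \<bullet> z))" for z
  proof -
    have e: "- q / 2 * (Z + Y) + i = - q / 2 * Y + (- q / 2 * Z + i)" for q Z Y i :: real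
      by (simp add: distrib_left)
    have i: "(y /\<^sub>R S') \<bullet> z = z \<bullet> y / S'"
      by (simp add: inner_commute[of y z] divide_inverse_commute)
    show ?thesis
      unfolding mehler_kernel_eq[OF r, of z y] S'_def[symmetric] C'_def[symmetric] k_def e i
      by (simp only: exp_add mult_ac)
  qed
  then have "(\<integral>\<^sup>+z. ennreal (mehler_kernel t x z) * ennreal (mehler_kernel r z y) \<partial>lborel) =
    (\<integral>\<^sup>+z. ennreal k * ennreal (mehler_kernel t x z * exp (- (C' / S') / 2 * (norm z)\<^sup>2 + (y /\<^sub>R S') \<bullet> z)) \<partial>lborel)"
    by (simp only: ennreal_mult'[symmetric] mehler_kernel_nonneg k0)
  also have "\<dots> = ennreal k * (\<integral>\<^sup>+z. ennreal (mehler_kernel t x z * exp (- (C' / S') / 2 * (norm z)\<^sup>2 + (y /\<^sub>R S') \<bullet> z)) \<partial>lborel)"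
    by (intro nn_integral_cmult) measurable
  also have "\<dots> = ennreal (k * ((S * (C / S + C' / S')) powr (- real DIM('a) / 2) *
      exp (- (C / S) / 2 * (norm x)\<^sup>2 + (norm (x /\<^sub>R S + y /\<^sub>R S'))\<^sup>2 / (2 * (C / S + C' / S')))))"
    using pos nn_integral_mehler_kernel_gaussian[OF t, of "C' / S'" x "y /\<^sub>R S'"]
    unfolding S_def[symmetric] C_def[symmetric]
    by (simp add: C'_def ennreal_mult' k_def)
  also have "C / S + C' / S' = U / (S * S')" using pos unfolding U by (simp add: field_simps)
  also have "k * ((S * (U / (S * S'))) powr (- real DIM('a) / 2) *
      exp (- (C / S) / 2 * (norm x)\<^sup>2 + (norm (x /\<^sub>R S + y /\<^sub>R S'))\<^sup>2 / (2 * (U / (S * S'))))) =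
      ((2 * pi * S') powr (- real DIM('a) / 2) * (U / S') powr (- real DIM('a) / 2)) *
      exp (- (C' / S') / 2 * (norm y)\<^sup>2 + (- (C / S) / 2 * (norm x)\<^sup>2 + (norm (x /\<^sub>R S + y /\<^sub>R S'))\<^sup>2 / (2 * (U / (S * S')))))"
  proof -
    have "S * (U / (S * S')) = U / S'" using pos by simp
    then show ?thesis unfolding k_def by (simp only: exp_add mult_ac)
  qed
  also have "(2 * pi * S') powr (- real DIM('a) / 2) * (U / S') powr (- real DIM('a) / 2) =
      (2 * pi * U) powr (- real DIM('a) / 2)"
    using pos by (simp add: powr_mult powr_divide)
  also have "- (C' / S') / 2 * (norm y)\<^sup>2 + (- (C / S) / 2 * (norm x)\<^sup>2 + (norm (x /\<^sub>R S + y /\<^sub>R S'))\<^sup>2 / (2 * (U / (S * S')))) =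
      - ((C * C' + S * S') / U) / 2 * ((norm x)\<^sup>2 + (norm y)\<^sup>2) + x \<bullet> y / U"
  proof -
    \<comment> \<open>Facts 1 and 2 are the coefficients of the squared norms of \<open>x\<close>
      and \<open>y\<close>. Both reduce to cosh^2 - sinh^2 = 1 and come out equal, as the symmetric
      form of the kernel demands.\<close>
    have 1: "S' / (S * U) - C / S = - ((C * C' + S * S') / U)"
    proof -
      have "S' / (S * U) - C / S = (S' - C * U) / (S * U)"
        using pos by (simp add: diff_divide_distrib)
      also have "S' - C * U = - (C * C' + S * S') * S"
        unfolding U using sq by algebra
      also have "\<dots> / (S * U) = - ((C * C' + S * S') / U)"
        using pos by (simp add: field_simps)
      finally show ?thesis .
    qed
    have 2: "S / (S' * U) - C' / S' = - ((C * C' + S * S') / U)"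
    proof -
      have "S / (S' * U) - C' / S' = (S - C' * U) / (S' * U)"
        using pos by (simp add: diff_divide_distrib)
      also have "S - C' * U = - (C * C' + S * S') * S'"
        unfolding U using sq by algebra
      also have "\<dots> / (S' * U) = - ((C * C' + S * S') / U)"
        using pos by (simp add: field_simps)
      finally show ?thesis .
    qed
    have "(norm (x /\<^sub>R S + y /\<^sub>R S'))\<^sup>2 = (norm x)\<^sup>2 / S\<^sup>2 + (norm y)\<^sup>2 / S'\<^sup>2 + 2 * (x \<bullet> y) / (S * S')"
      unfolding power2_norm_eq_inner
      by (simp add: inner_add_left inner_add_right inner_commute power2_eq_square field_simps)
    then have "(norm (x /\<^sub>R S + y /\<^sub>R S'))\<^sup>2 / (2 * (U / (S * S'))) =
        (S' / (S * U)) / 2 * (norm x)\<^sup>2 + (S / (S' * U)) / 2 * (norm y)\<^sup>2 + x \<bullet> y / U"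
      using pos by (simp add: field_simps power2_eq_square)
    then have "- (C' / S') / 2 * (norm y)\<^sup>2 + (- (C / S) / 2 * (norm x)\<^sup>2 + (norm (x /\<^sub>R S + y /\<^sub>R S'))\<^sup>2 / (2 * (U / (S * S')))) =
       (S' / (S * U) - C / S) / 2 * (norm x)\<^sup>2 + (S / (S' * U) - C' / S') / 2 * (norm y)\<^sup>2 + x \<bullet> y / U"
      by (simp add: field_simps)
    also have "\<dots> = - ((C * C' + S * S') / U) / 2 * ((norm x)\<^sup>2 + (norm y)\<^sup>2) + x \<bullet> y / U"
      unfolding 1 2 by (simp only: distrib_left)
    finally show ?thesis .
  qed
  finally show ?thesis
    using mehler_kernel_eq[of "t + r" x y] t r unfolding U_def[symmetric] CU by simp
qed

subsection \<open>Potential kernel\<close>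

text \<open>The weight for which H^(-s) is the integral of exp(-tH) over \<open>t\<close>. Its
  values are extended nonnegative so that Tonelli applies without integrability conditions, and the
  indicator removes the times at which the Mehler formula is meaningless.\<close>

definition gamma_weight :: "real \<Rightarrow> real \<Rightarrow> ennreal" where
  "gamma_weight s t = ennreal (t powr (s - 1) / Gamma s) * indicator {0<..} t"

lemma borel_measurable_gamma_weight [measurable]: "gamma_weight s \<in> borel_measurable borel"
  unfolding gamma_weight_def by measurable

lemma nn_integral_gamma_weight_exp:
  assumes "s > 0"
  shows "(\<integral>\<^sup>+t. gamma_weight s t * ennreal (exp (- t)) \<partial>lborel) = 1"
proof -
  have G: "Gamma s > 0" using assms by simp
  have "(\<integral>\<^sup>+t. gamma_weight s t * ennreal (exp (- t)) \<partial>lborel) =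
    (\<integral>\<^sup>+t. ennreal (1 / Gamma s) * ennreal (indicator {0..} t * t powr (s - 1) / exp t) \<partial>lborel)"
    using G by (intro nn_integral_cong)
      (auto simp: gamma_weight_def indicator_def exp_minus field_simps simp flip: ennreal_mult')
  also have "\<dots> = ennreal (1 / Gamma s) * ennreal (Gamma s)"
    by (simp add: nn_integral_cmult Gamma_conv_nn_integral_real[OF assms])
  also have "\<dots> = 1" using G by (simp flip: ennreal_mult')
  finally show ?thesis .
qed

lemma nn_integral_Beta:
  fixes s r :: real
  assumes "s > 0" "r > 0"
  shows "(\<integral>\<^sup>+t. ennreal (t powr (s - 1) * (1 - t) powr (r - 1)) * indicator {0<..<1} t \<partial>lborel) = ennreal (Beta s r)"
proof -
  have "(\<integral>\<^sup>+t. ennreal (t powr (s - 1) * (1 - t) powr (r - 1)) * indicator {0<..<1} t \<partial>lborel) =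
     (\<integral>\<^sup>+t. ennreal (indicator {0..1} t * (t powr (s - 1) * (1 - t) powr (r - 1))) \<partial>lborel)"
    by (intro nn_integral_cong) (auto simp: indicator_def)
  also have "\<dots> = ennreal (Beta s r)"
    by (intro nn_integral_has_integral_lebesgue has_integral_Beta_real assms) auto
  finally show ?thesis .
qed

text \<open>Scaling \<open>t\<close> by \<open>v\<close> collects the powers of \<open>v\<close>
  into \<open>v powr (s + r - 1)\<close> and leaves the Beta integral, whose Gamma quotient cancels
  the normalizations. If \<open>v\<close> is not positive, \<open>t\<close> and \<open>v - t\<close>
  are never both positive.\<close>

lemma gamma_weight_convolution:
  assumes s: "s > 0" and r: "r > 0"
  shows "(\<integral>\<^sup>+t. gamma_weight s t * gamma_weight r (v - t) \<partial>lborel) = gamma_weight (s + r) v"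
proof (cases "v > 0")
  case False
  have "gamma_weight s t * gamma_weight r (v - t) = 0" for t
    using False by (auto simp: gamma_weight_def indicator_def)
  then show ?thesis using False by (simp add: gamma_weight_def[of "s + r"] del: mult_eq_0_iff)
next
  case True
  have G: "Gamma s > 0" "Gamma r > 0" "Gamma (s + r) > 0" using s r by auto
  define c where "c = v powr (s + r - 1) / (Gamma s * Gamma r)"
  have c: "c \<ge> 0" using G by (simp add: c_def)
  have "(\<integral>\<^sup>+t. gamma_weight s t * gamma_weight r (v - t) \<partial>lborel) =
      ennreal v * (\<integral>\<^sup>+t. gamma_weight s (0 + v * t) * gamma_weight r (v - (0 + v * t)) \<partial>lborel)"
    using True by (subst nn_integral_real_affine[where c = v and t = 0]) auto
  also have "\<dots> = (\<integral>\<^sup>+t. ennreal v * (gamma_weight s (0 + v * t) * gamma_weight r (v - (0 + v * t))) \<partial>lborel)"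
    by (rule nn_integral_cmult[symmetric]) measurable
  also have "\<dots> = (\<integral>\<^sup>+t. ennreal c * (ennreal (t powr (s - 1) * (1 - t) powr (r - 1)) * indicator {0<..<1} t) \<partial>lborel)"
  proof (intro nn_integral_cong)
    fix t
    have I: "indicator {0<..} (0 + v * t) * indicator {0<..} (v - (0 + v * t)) = (indicator {0<..<1} t :: ennreal)"
      using True by (auto simp: indicator_def zero_less_mult_iff)
    have "v * ((v * t) powr (s - 1) / Gamma s * ((v - v * t) powr (r - 1) / Gamma r)) =
        c * (t powr (s - 1) * (1 - t) powr (r - 1))" if "0 < t" "t < 1"
    proof -
      have "(v * t) powr (s - 1) = v powr (s - 1) * t powr (s - 1)"
        using True that by (simp add: powr_mult)
      moreover have "(v - v * t) powr (r - 1) = v powr (r - 1) * (1 - t) powr (r - 1)"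
        using True that powr_mult[of v "1 - t" "r - 1"] by (simp add: right_diff_distrib)
      moreover have "v powr (s + r - 1) = v * v powr (s - 1) * v powr (r - 1)"
      proof -
        have "v * v powr (s - 1) * v powr (r - 1) = v powr (1 + (s - 1) + (r - 1))"
          using True by (simp only: powr_add powr_one)
        then show ?thesis by (simp add: algebra_simps)
      qed
      ultimately show ?thesis unfolding c_def by simp
    qed
    then have "ennreal (v * ((v * t) powr (s - 1) / Gamma s * ((v - v * t) powr (r - 1) / Gamma r))) * indicator {0<..<1} t =
        ennreal (c * (t powr (s - 1) * (1 - t) powr (r - 1))) * indicator {0<..<1} t"
      by (auto simp: indicator_def)
    moreover have "ennreal v * (gamma_weight s (0 + v * t) * gamma_weight r (v - (0 + v * t))) =
       ennreal (v * ((v * t) powr (s - 1) / Gamma s * ((v - v * t) powr (r - 1) / Gamma r))) * indicator {0<..<1} t"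
    proof -
      have "ennreal (v * ((v * t) powr (s - 1) / Gamma s * ((v - v * t) powr (r - 1) / Gamma r))) =
          ennreal v * (ennreal ((v * t) powr (s - 1) / Gamma s) * ennreal ((v - v * t) powr (r - 1) / Gamma r))"
        by (subst ennreal_mult', use True in simp, subst ennreal_mult', use G in simp, rule refl)
      then show ?thesis unfolding gamma_weight_def I[symmetric] by (simp add: mult_ac)
    qed
    ultimately show "ennreal v * (gamma_weight s (0 + v * t) * gamma_weight r (v - (0 + v * t))) =
        ennreal c * (ennreal (t powr (s - 1) * (1 - t) powr (r - 1)) * indicator {0<..<1} t)"
      by (simp only: ennreal_mult'[OF c] mult.assoc)
  qed
  also have "\<dots> = ennreal (c * Beta s r)"
    unfolding ennreal_mult'[OF c] nn_integral_Beta[OF s r, symmetric] by (rule nn_integral_cmult) measurable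
  also have "c * Beta s r = v powr (s + r - 1) / Gamma (s + r)"
    using G by (simp add: c_def Beta_def)
  finally show ?thesis using True by (simp add: gamma_weight_def)
qed

text \<open>Substituting u = v - t and exchanging the integrals isolates the convolution of the
  weights. With \<open>h\<close> the Mehler kernel as a function of time, this is the scalar part of
  H^(-s) H^(-r) = H^(-(s+r)).\<close>

lemma nn_integral_gamma_weight_mult:
  assumes s: "s > 0" and r: "r > 0" and [measurable]: "h \<in> borel_measurable borel"
  shows "(\<integral>\<^sup>+t. \<integral>\<^sup>+u. gamma_weight s t * gamma_weight r u * h (t + u) \<partial>lborel \<partial>lborel) =
         (\<integral>\<^sup>+v. gamma_weight (s + r) v * h v \<partial>lborel)"
proof -
  have "(\<integral>\<^sup>+t. \<integral>\<^sup>+u. gamma_weight s t * gamma_weight r u * h (t + u) \<partial>lborel \<partial>lborel) =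
     (\<integral>\<^sup>+t. \<integral>\<^sup>+v. gamma_weight s t * gamma_weight r (v - t) * h v \<partial>lborel \<partial>lborel)"
  proof (rule nn_integral_cong)
    fix t :: real
    show "(\<integral>\<^sup>+u. gamma_weight s t * gamma_weight r u * h (t + u) \<partial>lborel) =
        (\<integral>\<^sup>+v. gamma_weight s t * gamma_weight r (v - t) * h v \<partial>lborel)"
      using nn_integral_real_affine[of "\<lambda>v. gamma_weight s t * gamma_weight r (v - t) * h v" 1 t] by simp
  qed
  also have "\<dots> = (\<integral>\<^sup>+v. \<integral>\<^sup>+t. gamma_weight s t * gamma_weight r (v - t) * h v \<partial>lborel \<partial>lborel)"
    by (rule lborel_pair.Fubini') measurable
  also have "\<dots> = (\<integral>\<^sup>+v. gamma_weight (s + r) v * h v \<partial>lborel)"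
    by (simp add: nn_integral_multc gamma_weight_convolution[OF s r])
  finally show ?thesis .
qed

text \<open>
  Unlike \<^const>\<open>potential_kernel\<close>, which is \<open>0\<close> wherever its integral diverges, this version is
  infinite there, so that Tonelli's theorem gives identities that hold at every point.
\<close>

definition nn_potential_kernel :: "real \<Rightarrow> 'a::euclidean_space \<Rightarrow> 'a \<Rightarrow> ennreal" where
  "nn_potential_kernel s x y = (\<integral>\<^sup>+t. gamma_weight s t * ennreal (mehler_kernel t x y) \<partial>lborel)"

lemma borel_measurable_nn_potential_kernel [measurable (raw)]:
  assumes [measurable]: "g \<in> M \<rightarrow>\<^sub>M borel" "h \<in> M \<rightarrow>\<^sub>M borel"
  shows "(\<lambda>w. nn_potential_kernel s (g w) (h w :: 'a::euclidean_space)) \<in> borel_measurable M"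
  unfolding nn_potential_kernel_def by measurable

lemma borel_measurable_potential_kernel_comp [measurable (raw)]:
  assumes [measurable]: "g \<in> M \<rightarrow>\<^sub>M borel" "h \<in> M \<rightarrow>\<^sub>M borel"
  shows "(\<lambda>w. potential_kernel s (g w) (h w :: 'a::euclidean_space)) \<in> borel_measurable M"
  using measurable_compose[OF _ borel_measurable_potential_kernel, of "\<lambda>w. (g w, h w)" M s] by simp

text \<open>Divergence does no harm: the Bochner integral then defaults to 0, and
  \<open>enn2real\<close> also sends infinity to 0.\<close>

lemma potential_kernel_eq_enn2real:
  assumes "s > 0"
  shows "potential_kernel s x y = enn2real (nn_potential_kernel s x y)"
proof -
  have G: "Gamma s > 0" using assms by simp
  have "potential_kernel s x y =
     (LBINT t. indicator {0<..} t * (t powr (s - 1) / Gamma s * mehler_kernel t x y))"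
    unfolding potential_kernel_def set_lebesgue_integral_def
    by (subst integral_mult_right_zero[symmetric]) (simp add: mult_ac)
  also have "\<dots> = enn2real (\<integral>\<^sup>+t. ennreal (indicator {0<..} t * (t powr (s - 1) / Gamma s * mehler_kernel t x y)) \<partial>lborel)"
    using G by (intro integral_eq_nn_integral) (auto intro!: AE_I2)
  also have "(\<integral>\<^sup>+t. ennreal (indicator {0<..} t * (t powr (s - 1) / Gamma s * mehler_kernel t x y)) \<partial>lborel) =
     nn_potential_kernel s x y"
    unfolding nn_potential_kernel_def gamma_weight_def
    using G by (intro nn_integral_cong) (auto simp: indicator_def simp flip: ennreal_mult')
  finally show ?thesis .
qed

lemma potential_kernel_nonneg: "s > 0 \<Longrightarrow> 0 \<le> potential_kernel s x y"
  by (simp add: potential_kernel_eq_enn2real)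

lemma nn_potential_kernel_commute: "nn_potential_kernel s x y = nn_potential_kernel s y x"
  unfolding nn_potential_kernel_def by (subst mehler_kernel_commute) (rule refl)

lemma potential_kernel_commute: "potential_kernel s x y = potential_kernel s y x"
  unfolding potential_kernel_def by (subst mehler_kernel_commute) (rule refl)

text \<open>Tonelli moves the \<open>y\<close>-integral onto the Mehler kernel, whose mass is at
  most 2 exp(-t). What remains is twice Euler's integral for Gamma, normalized to 1.\<close>

lemma nn_integral_nn_potential_kernel_le:
  fixes x :: "'a::euclidean_space"
  assumes "s > 0"
  shows "(\<integral>\<^sup>+y. nn_potential_kernel s x y \<partial>lborel) \<le> 2"
proof -
  have "(\<integral>\<^sup>+y. nn_potential_kernel s x y \<partial>lborel) =
    (\<integral>\<^sup>+t. \<integral>\<^sup>+y. gamma_weight s t * ennreal (mehler_kernel t x y) \<partial>lborel \<partial>lborel)"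
    unfolding nn_potential_kernel_def by (rule lborel_pair.Fubini') measurable
  also have "\<dots> = (\<integral>\<^sup>+t. gamma_weight s t * (\<integral>\<^sup>+y. ennreal (mehler_kernel t x y) \<partial>lborel) \<partial>lborel)"
    by (intro nn_integral_cong nn_integral_cmult) measurable
  also have "\<dots> \<le> (\<integral>\<^sup>+t. 2 * (gamma_weight s t * ennreal (exp (- t))) \<partial>lborel)"
  proof (intro nn_integral_mono)
    fix t :: real
    have "gamma_weight s t * (\<integral>\<^sup>+y. ennreal (mehler_kernel t x y) \<partial>lborel) \<le> gamma_weight s t * ennreal (2 * exp (- t))"
      by (cases "t > 0") (auto intro!: mult_left_mono nn_integral_mehler_kernel_le simp: gamma_weight_def)
    then show "gamma_weight s t * (\<integral>\<^sup>+y. ennreal (mehler_kernel t x y) \<partial>lborel) \<le> 2 * (gamma_weight s t * ennreal (exp (- t)))"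
      by (simp add: ennreal_mult' mult_ac)
  qed
  also have "\<dots> = 2"
    by (simp add: nn_integral_cmult nn_integral_gamma_weight_exp[OF assms])
  finally show ?thesis .
qed

text \<open>Tonelli makes \<open>z\<close> the innermost variable, the Mehler semigroup law
  evaluates that integral, and the convolution of the weights evaluates the other two.\<close>

lemma nn_integral_nn_potential_kernel_mult:
  fixes x y :: "'a::euclidean_space"
  assumes s: "s > 0" and r: "r > 0"
  shows "(\<integral>\<^sup>+z. nn_potential_kernel s x z * nn_potential_kernel r z y \<partial>lborel) = nn_potential_kernel (s + r) x y"
proof -
  have "(\<integral>\<^sup>+z. nn_potential_kernel s x z * nn_potential_kernel r z y \<partial>lborel) =
    (\<integral>\<^sup>+z. \<integral>\<^sup>+t. \<integral>\<^sup>+u. gamma_weight s t * gamma_weight r u *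
       (ennreal (mehler_kernel t x z) * ennreal (mehler_kernel u z y)) \<partial>lborel \<partial>lborel \<partial>lborel)"
    unfolding nn_potential_kernel_def
    by (simp add: nn_integral_multc[symmetric] nn_integral_cmult[symmetric] mult_ac)
  also have "\<dots> = (\<integral>\<^sup>+t. \<integral>\<^sup>+z. \<integral>\<^sup>+u. gamma_weight s t * gamma_weight r u *
       (ennreal (mehler_kernel t x z) * ennreal (mehler_kernel u z y)) \<partial>lborel \<partial>lborel \<partial>lborel)"
    by (rule lborel_pair.Fubini') measurable
  also have "\<dots> = (\<integral>\<^sup>+t. \<integral>\<^sup>+u. \<integral>\<^sup>+z. gamma_weight s t * gamma_weight r u *
       (ennreal (mehler_kernel t x z) * ennreal (mehler_kernel u z y)) \<partial>lborel \<partial>lborel \<partial>lborel)"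
    by (intro nn_integral_cong lborel_pair.Fubini') measurable
  also have "\<dots> = (\<integral>\<^sup>+t. \<integral>\<^sup>+u. gamma_weight s t * gamma_weight r u * ennreal (mehler_kernel (t + u) x y) \<partial>lborel \<partial>lborel)"
  proof (intro nn_integral_cong)
    \<comment> \<open>The semigroup law covers positive times; at all others a gamma weight makes
      both sides 0.\<close>
    fix t u :: real
    have "(\<integral>\<^sup>+z. gamma_weight s t * gamma_weight r u *
       (ennreal (mehler_kernel t x z) * ennreal (mehler_kernel u z y)) \<partial>lborel) =
       gamma_weight s t * gamma_weight r u * (\<integral>\<^sup>+z. ennreal (mehler_kernel t x z) * ennreal (mehler_kernel u z y) \<partial>lborel)"
      by (rule nn_integral_cmult) measurable
    then show "(\<integral>\<^sup>+z. gamma_weight s t * gamma_weight r u *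
       (ennreal (mehler_kernel t x z) * ennreal (mehler_kernel u z y)) \<partial>lborel) =
       gamma_weight s t * gamma_weight r u * ennreal (mehler_kernel (t + u) x y)"
      by (cases "t > 0 \<and> u > 0") (auto simp: nn_integral_mehler_kernel_mult gamma_weight_def)
  qed
  also have "\<dots> = nn_potential_kernel (s + r) x y"
    unfolding nn_potential_kernel_def by (rule nn_integral_gamma_weight_mult[OF s r]) measurable
  finally show ?thesis .
qed

text \<open>A function with finite integral is finite almost everywhere, and \<open>enn2real\<close>
  loses nothing at finite values. The exceptional null set depends on \<open>x\<close>.\<close>

lemma AE_potential_kernel:
  fixes x :: "'a::euclidean_space"
  assumes "s > 0"
  shows "AE y in lborel. ennreal (potential_kernel s x y) = nn_potential_kernel s x y"
proof -
  have "(\<integral>\<^sup>+y. nn_potential_kernel s x y \<partial>lborel) \<noteq> \<infinity>"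
    using nn_integral_nn_potential_kernel_le[OF assms, of x] by (auto simp: top_unique)
  then have "AE y in lborel. nn_potential_kernel s x y \<noteq> \<infinity>"
    by (intro nn_integral_noteq_infinite) auto
  then show ?thesis
    by eventually_elim (simp add: potential_kernel_eq_enn2real[OF assms] less_top)
qed

lemma nn_integral_potential_kernel_le:
  fixes x :: "'a::euclidean_space"
  assumes "s > 0"
  shows "(\<integral>\<^sup>+y. ennreal (potential_kernel s x y) \<partial>lborel) \<le> 2"
  using nn_integral_nn_potential_kernel_le[OF assms, of x]
    nn_integral_cong_AE[OF AE_potential_kernel[OF assms, of x]] by simp

text \<open>Both factors may be replaced by their extended versions for almost every
  \<open>z\<close>; symmetry of the kernel handles the one with \<open>z\<close> in first position.
  The right side stays extended because the integral can diverge for particular \<open>x\<close> and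
  \<open>y\<close>.\<close>

lemma nn_integral_potential_kernel_mult:
  fixes x y :: "'a::euclidean_space"
  assumes s: "s > 0" and r: "r > 0"
  shows "(\<integral>\<^sup>+z. ennreal (potential_kernel s x z) * ennreal (potential_kernel r z y) \<partial>lborel) = nn_potential_kernel (s + r) x y"
proof -
  have "AE z in lborel. ennreal (potential_kernel s x z) * ennreal (potential_kernel r z y) =
      nn_potential_kernel s x z * nn_potential_kernel r z y"
    using AE_potential_kernel[OF s, of x] AE_potential_kernel[OF r, of y]
    by eventually_elim (simp add: potential_kernel_commute[of r _ y] nn_potential_kernel_commute[of r _ y])
  then show ?thesis
    using nn_integral_nn_potential_kernel_mult[OF s r, of x y] by (simp cong: nn_integral_cong_AE)
qed

subsection \<open>The operators on \<open>L\<^sup>p\<close>\<close>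

text \<open>
  A weak form of Jensen's inequality: integrate \<open>u \<le> \<lambda> + \<lambda>\<^sup>1\<^sup>-\<^sup>p u\<^sup>p\<close> against the weight and
  choose \<open>\<lambda>\<close> proportional to the integral of \<open>u\<close>.
\<close>

lemma le_add_powr:
  fixes u l p :: real
  assumes "u \<ge> 0" "l > 0" "p \<ge> 1"
  shows "u \<le> l + l powr (1 - p) * u powr p"
proof (cases "u \<le> l")
  case True
  then show ?thesis by (intro add_increasing2) auto
next
  case False
  then have "u = u powr (1 - p) * u powr p" using assms by (simp flip: powr_add)
  also have "\<dots> \<le> l powr (1 - p) * u powr p"
    using False assms by (intro mult_right_mono powr_mono2') auto
  finally show ?thesis using assms by simp
qed

lemma weighted_powr_integral:
  fixes k :: "'a \<Rightarrow> real" and f :: "'a \<Rightarrow> 'b::euclidean_space"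
  assumes p: "p \<ge> 1" and C: "C > 0" and k: "integrable M k" "\<And>y. k y \<ge> 0" "(LINT y|M. k y) \<le> C"
    and f [measurable]: "f \<in> borel_measurable M" and kf: "integrable M (\<lambda>y. k y * norm (f y) powr p)"
  shows "integrable M (\<lambda>y. k y *\<^sub>R f y)"
    and "norm (LINT y|M. k y *\<^sub>R f y) powr p \<le> (2 * C) powr p / C * (LINT y|M. k y * norm (f y) powr p)"
proof -
  have [measurable]: "k \<in> borel_measurable M" using k by auto
  have le: "k y * norm (f y) \<le> k y * l + l powr (1 - p) * (k y * norm (f y) powr p)" if "l > 0" for y l
    using mult_left_mono[OF le_add_powr[OF norm_ge_zero that p, of "f y"] k(2)[of y]]
    by (simp add: algebra_simps)
  \<comment> \<open>The pointwise inequality with l = 1 provides an integrable majorant.\<close>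
  have int: "integrable M (\<lambda>y. k y * norm (f y))"
  proof (rule Bochner_Integration.integrable_bound)
    show "integrable M (\<lambda>y. k y + k y * norm (f y) powr p)"
      using k kf by (intro Bochner_Integration.integrable_add) auto
    show "AE y in M. norm (k y * norm (f y)) \<le> norm (k y + k y * norm (f y) powr p)"
      using le[of 1] k(2) by (intro AE_I2) (simp add: abs_of_nonneg)
  qed measurable
  then show int': "integrable M (\<lambda>y. k y *\<^sub>R f y)"
    by (rule Bochner_Integration.integrable_bound) (auto intro!: AE_I2 simp: k(2))
  define I J where "I = (LINT y|M. k y * norm (f y))" and "J = (LINT y|M. k y * norm (f y) powr p)"
  have J0: "J \<ge> 0" unfolding J_def using k(2) by (intro integral_nonneg_AE) auto
  have I0: "I \<ge> 0" unfolding I_def using k(2) by (intro integral_nonneg_AE) auto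
  have nI: "norm (LINT y|M. k y *\<^sub>R f y) \<le> I"
    unfolding I_def using integral_norm_bound[of M "\<lambda>y. k y *\<^sub>R f y"] k(2) by simp
  have "I powr p \<le> (2 * C) powr p / C * J"
  proof (cases "I = 0")
    case True
    then show ?thesis using J0 C by simp
  next
    case False
    \<comment> \<open>With this choice \<open>C * l\<close> is half of \<open>I\<close> and can be
      absorbed into the left side.\<close>
    define l where "l = I / (2 * C)"
    have l: "l > 0" using False I0 C by (simp add: l_def)
    have "I \<le> (LINT y|M. k y * l + l powr (1 - p) * (k y * norm (f y) powr p))"
      unfolding I_def using k kf le[OF l] int by (intro integral_mono) auto
    also have "\<dots> = (LINT y|M. k y) * l + l powr (1 - p) * J"
      unfolding J_def using k kf by simp
    also have "\<dots> \<le> C * l + l powr (1 - p) * J"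
      using k(3) l by (intro add_right_mono mult_right_mono) auto
    finally have "C * l \<le> l powr (1 - p) * J" using C by (simp add: l_def)
    then have "l powr (p - 1) * (C * l) \<le> l powr (p - 1) * (l powr (1 - p) * J)"
      by (intro mult_left_mono) auto
    also have "\<dots> = J" using l by (simp flip: powr_add mult.assoc)
    also have "l powr (p - 1) * (C * l) = C * l powr p"
      using l by (simp add: powr_diff)
    finally have "l powr p \<le> J / C" using C by (simp add: field_simps)
    moreover have "I powr p = (2 * C) powr p * l powr p"
      using C l by (simp add: l_def powr_divide I0)
    ultimately show ?thesis using C by (simp add: divide_simps mult.commute)
  qed
  moreover have "norm (LINT y|M. k y *\<^sub>R f y) powr p \<le> I powr p"
    using nI p by (intro powr_mono2) auto
  ultimately show "norm (LINT y|M. k y *\<^sub>R f y) powr p \<le> (2 * C) powr p / C * (LINT y|M. k y * norm (f y) powr p)"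
    unfolding J_def by linarith
qed

text \<open>The weak Jensen inequality is applied at each \<open>x\<close> with weight
  \<open>K x\<close>, whose mass is the row bound. Integrating over \<open>x\<close> and using
  Tonelli with the column bound costs a further factor \<open>C\<close>, which turns
  \<open>(2 * C) powr p / C\<close> into \<open>(2 * C) powr p\<close>.\<close>

lemma schur_test:
  fixes K :: "'a::euclidean_space \<Rightarrow> 'a \<Rightarrow> real" and f :: "'a \<Rightarrow> 'b::euclidean_space"
  assumes p: "p \<ge> 1" and C: "C > 0"
    and K [measurable]: "(\<lambda>(x, y). K x y) \<in> borel_measurable (lborel \<Otimes>\<^sub>M lborel)" and K0: "\<And>x y. K x y \<ge> 0"
    and row: "\<And>x. (\<integral>\<^sup>+y. ennreal (K x y) \<partial>lborel) \<le> ennreal C"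
    and col: "\<And>y. (\<integral>\<^sup>+x. ennreal (K x y) \<partial>lborel) \<le> ennreal C"
    and f [measurable]: "f \<in> borel_measurable lborel" and fp: "integrable lborel (\<lambda>x. norm (f x) powr p)"
  shows "AE x in lborel. integrable lborel (\<lambda>y. K x y *\<^sub>R f y)"
    and "integrable lborel (\<lambda>x. norm (LINT y|lborel. K x y *\<^sub>R f y) powr p)"
    and "(LINT x|lborel. norm (LINT y|lborel. K x y *\<^sub>R f y) powr p) \<le> (2 * C) powr p * (LINT x|lborel. norm (f x) powr p)"
proof -
  define J where "J x = (\<integral>\<^sup>+y. ennreal (K x y * norm (f y) powr p) \<partial>lborel)" for x
  have [measurable]: "J \<in> borel_measurable lborel" unfolding J_def by measurable
  have k: "integrable lborel (K x)" "(LINT y|lborel. K x y) \<le> C" for x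
  proof -
    show int: "integrable lborel (K x)"
      using row[of x] K0 by (intro integrableI_bounded) (auto simp: less_top[symmetric] top_unique)
    have "ennreal (LINT y|lborel. K x y) \<le> ennreal C"
      using row[of x] K0 nn_integral_eq_integral[OF int] by simp
    then show "(LINT y|lborel. K x y) \<le> C" using C by (simp add: ennreal_le_iff)
  qed
  have "(\<integral>\<^sup>+x. J x \<partial>lborel) = (\<integral>\<^sup>+y. \<integral>\<^sup>+x. ennreal (K x y * norm (f y) powr p) \<partial>lborel \<partial>lborel)"
    unfolding J_def by (rule lborel_pair.Fubini') measurable
  also have "\<dots> = (\<integral>\<^sup>+y. (\<integral>\<^sup>+x. ennreal (K x y) \<partial>lborel) * ennreal (norm (f y) powr p) \<partial>lborel)"
    using K0 by (simp add: ennreal_mult' nn_integral_multc)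
  also have "\<dots> \<le> (\<integral>\<^sup>+y. ennreal C * ennreal (norm (f y) powr p) \<partial>lborel)"
    using col by (intro nn_integral_mono mult_right_mono) auto
  also have "\<dots> = ennreal C * ennreal (LINT x|lborel. norm (f x) powr p)"
    using fp by (simp add: nn_integral_cmult nn_integral_eq_integral)
  finally have J: "(\<integral>\<^sup>+x. J x \<partial>lborel) \<le> ennreal C * ennreal (LINT x|lborel. norm (f x) powr p)" .
  have kf: "integrable lborel (\<lambda>y. K x y * norm (f y) powr p)"
      "J x = ennreal (LINT y|lborel. K x y * norm (f y) powr p)" if "J x \<noteq> \<infinity>" for x
  proof -
    show int: "integrable lborel (\<lambda>y. K x y * norm (f y) powr p)"
      using that K0 unfolding J_def by (intro integrableI_bounded) (auto simp: less_top[symmetric])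
    show "J x = ennreal (LINT y|lborel. K x y * norm (f y) powr p)"
      unfolding J_def using K0 by (intro nn_integral_eq_integral int) auto
  qed
  have "(\<integral>\<^sup>+x. J x \<partial>lborel) \<noteq> \<infinity>"
    using J by (auto simp: top_unique ennreal_mult_eq_top_iff)
  then have "AE x in lborel. J x \<noteq> \<infinity>" by (intro nn_integral_noteq_infinite) auto
  then show "AE x in lborel. integrable lborel (\<lambda>y. K x y *\<^sub>R f y)"
    by eventually_elim (intro weighted_powr_integral(1)[OF p C k(1) K0 k(2)] kf f)
  \<comment> \<open>Stated at every \<open>x\<close>: where \<open>J x\<close> is infinite the right
    side is infinite too.\<close>
  have le: "ennreal (norm (LINT y|lborel. K x y *\<^sub>R f y) powr p) \<le> ennreal ((2 * C) powr p / C) * J x" for x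
  proof (cases "J x = \<infinity>")
    case True
    then show ?thesis using C by (simp add: ennreal_mult_top)
  next
    case False
    then show ?thesis
      using weighted_powr_integral(2)[OF p C k(1) K0 k(2) f kf(1)] C
      by (simp add: kf(2) ennreal_mult'[symmetric] ennreal_leI)
  qed
  have "(\<integral>\<^sup>+x. ennreal (norm (LINT y|lborel. K x y *\<^sub>R f y) powr p) \<partial>lborel) \<le> ennreal ((2 * C) powr p / C) * (\<integral>\<^sup>+x. J x \<partial>lborel)"
    using le by (subst nn_integral_cmult[symmetric]) (auto intro!: nn_integral_mono)
  also have "\<dots> \<le> ennreal ((2 * C) powr p / C) * (ennreal C * ennreal (LINT x|lborel. norm (f x) powr p))"
    by (intro mult_left_mono J) simp
  also have "\<dots> = ennreal ((2 * C) powr p * (LINT x|lborel. norm (f x) powr p))"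
    using C by (simp flip: ennreal_mult')
  finally have *: "(\<integral>\<^sup>+x. ennreal (norm (LINT y|lborel. K x y *\<^sub>R f y) powr p) \<partial>lborel) \<le>
     ennreal ((2 * C) powr p * (LINT x|lborel. norm (f x) powr p))" .
  show int: "integrable lborel (\<lambda>x. norm (LINT y|lborel. K x y *\<^sub>R f y) powr p)"
    by (rule integrableI_bounded, measurable) (use * in \<open>auto simp: less_top[symmetric] top_unique\<close>)
  have "ennreal (LINT x|lborel. norm (LINT y|lborel. K x y *\<^sub>R f y) powr p) \<le> ennreal ((2 * C) powr p * (LINT x|lborel. norm (f x) powr p))"
    using * by (subst nn_integral_eq_integral[OF int, symmetric]) auto
  then show "(LINT x|lborel. norm (LINT y|lborel. K x y *\<^sub>R f y) powr p) \<le> (2 * C) powr p * (LINT x|lborel. norm (f x) powr p)"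
    by (subst (asm) ennreal_le_iff) (auto intro!: mult_nonneg_nonneg integral_nonneg_AE)
qed

section \<open>Boundedness and composition of the operators\<close>

text \<open>The operator H^(-s) on functions; \<open>hermite_power\<close> is its lift to classes
  modulo null sets.\<close>

definition potential :: "real \<Rightarrow> ('a::euclidean_space \<Rightarrow> 'k::euclidean_space) \<Rightarrow> 'a \<Rightarrow> 'k" where
  "potential s f x = (LINT y|lborel. potential_kernel s x y *\<^sub>R f y)"

lemma borel_measurable_potential [measurable]:
  assumes [measurable]: "f \<in> borel_measurable lborel"
  shows "potential s f \<in> borel_measurable lborel"
  unfolding potential_def by measurable

text \<open>Schur test with C = 2: rows by the mass bound, columns by symmetry of the kernel. The
  constant 4 is 2 * C.\<close>

lemma
  fixes f :: "'a::euclidean_space \<Rightarrow> 'k::euclidean_space"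
  assumes s: "s > 0" and p: "p \<ge> 1"
    and f: "f \<in> borel_measurable lborel" "integrable lborel (\<lambda>x. norm (f x) powr p)"
  shows AE_integrable_potential: "AE x in lborel. integrable lborel (\<lambda>y. potential_kernel s x y *\<^sub>R f y)"
    and integrable_potential_powr: "integrable lborel (\<lambda>x. norm (potential s f x) powr p)"
    and integral_potential_powr_le:
      "(LINT x|lborel. norm (potential s f x) powr p) \<le> 4 powr p * (LINT x|lborel. norm (f x) powr p)"
proof -
  have row: "(\<integral>\<^sup>+y. ennreal (potential_kernel s x y) \<partial>lborel) \<le> ennreal 2" for x :: 'a
    using nn_integral_potential_kernel_le[OF s, of x] by simp
  have col: "(\<integral>\<^sup>+x. ennreal (potential_kernel s x y) \<partial>lborel) \<le> ennreal 2" for y :: 'a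
    using row[of y] by (simp add: potential_kernel_commute[of s _ y])
  note * = schur_test[OF p _ borel_measurable_potential_kernel potential_kernel_nonneg[OF s] row col f]
  show "AE x in lborel. integrable lborel (\<lambda>y. potential_kernel s x y *\<^sub>R f y)"
    "integrable lborel (\<lambda>x. norm (potential s f x) powr p)"
    "(LINT x|lborel. norm (potential s f x) powr p) \<le> 4 powr p * (LINT x|lborel. norm (f x) powr p)"
    using * unfolding potential_def by simp_all
qed

text \<open>Fubini at every \<open>x\<close> where the integral defining
  \<open>potential (s + r) f x\<close> converges absolutely. Integrating the absolute value of the
  double integrand over \<open>z\<close> first gives exactly that integral with norms, by the
  composition law of the kernels.\<close>

lemma AE_potential_potential:
  fixes f :: "'a::euclidean_space \<Rightarrow> 'k::euclidean_space"
  assumes s: "s > 0" and r: "r > 0" and p: "p \<ge> 1"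
    and f [measurable]: "f \<in> borel_measurable lborel" and fp: "integrable lborel (\<lambda>x. norm (f x) powr p)"
  shows "AE x in lborel. potential s (potential r f) x = potential (s + r) f x"
proof -
  have sr: "s + r > 0" using s r by simp
  show ?thesis
    using AE_integrable_potential[OF sr p f fp]
  proof eventually_elim
    case (elim x)
    define h where "h z y = (potential_kernel s x z * potential_kernel r z y) *\<^sub>R f y" for z y
    have [measurable]: "(\<lambda>(z, y). h z y) \<in> borel_measurable (lborel \<Otimes>\<^sub>M lborel)"
      unfolding h_def by measurable
    have kk: "(\<integral>\<^sup>+z. ennreal (potential_kernel s x z * potential_kernel r z y) \<partial>lborel) = nn_potential_kernel (s + r) x y" for y
      using nn_integral_potential_kernel_mult[OF s r, of x y] by (simp add: ennreal_mult' potential_kernel_nonneg s r)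
    have "(\<integral>\<^sup>+w. ennreal (norm (case_prod h w)) \<partial>(lborel \<Otimes>\<^sub>M lborel)) =
        (\<integral>\<^sup>+y. \<integral>\<^sup>+z. ennreal (norm (h z y)) \<partial>lborel \<partial>lborel)"
      by (subst lborel_pair.nn_integral_snd[symmetric]) auto
    also have "\<dots> = (\<integral>\<^sup>+y. (\<integral>\<^sup>+z. ennreal (potential_kernel s x z * potential_kernel r z y) \<partial>lborel) * ennreal (norm (f y)) \<partial>lborel)"
      unfolding h_def using s r by (simp add: nn_integral_multc[symmetric] potential_kernel_nonneg ennreal_mult')
    also have "\<dots> = (\<integral>\<^sup>+y. ennreal (norm (potential_kernel (s + r) x y *\<^sub>R f y)) \<partial>lborel)"
      using AE_potential_kernel[OF sr, of x] unfolding kk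
      by (intro nn_integral_cong_AE, eventually_elim) (simp add: potential_kernel_nonneg sr ennreal_mult')
    also have "\<dots> < \<infinity>" using elim by (simp add: integrable_iff_bounded)
    finally have int: "integrable (lborel \<Otimes>\<^sub>M lborel) (case_prod h)"
      by (intro integrableI_bounded) auto
    have "potential s (potential r f) x = (LINT z|lborel. LINT y|lborel. h z y)"
      unfolding potential_def[of s]
    proof (rule integral_cong_AE)
      show "AE z in lborel. potential_kernel s x z *\<^sub>R potential r f z = (LINT y|lborel. h z y)"
        using AE_integrable_potential[OF r p f fp]
        by eventually_elim (simp add: potential_def h_def flip: scaleR_scaleR)
    qed measurable
    also have "\<dots> = (LINT y|lborel. LINT z|lborel. h z y)"
      using lborel_pair.Fubini_integral[OF int] by simp
    also have "\<dots> = potential (s + r) f x"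
      unfolding potential_def[of "s + r"]
    proof (rule integral_cong_AE)
      \<comment> \<open>Where the extended kernel is finite, the Tonelli identity for the
        \<open>z\<close>-integral becomes one between Bochner integrals.\<close>
      show "AE y in lborel. (LINT z|lborel. h z y) = potential_kernel (s + r) x y *\<^sub>R f y"
        using AE_potential_kernel[OF sr, of x]
      proof eventually_elim
        case (elim y)
        have fin: "(\<integral>\<^sup>+z. ennreal (potential_kernel s x z * potential_kernel r z y) \<partial>lborel) = ennreal (potential_kernel (s + r) x y)"
          unfolding kk elim ..
        then have "integrable lborel (\<lambda>z. potential_kernel s x z * potential_kernel r z y)"
          by (intro integrableI_bounded) (auto simp: potential_kernel_nonneg s r)
        moreover have "(LINT z|lborel. potential_kernel s x z * potential_kernel r z y) = potential_kernel (s + r) x y"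
          by (subst integral_eq_nn_integral) (auto simp: fin potential_kernel_nonneg s r sr)
        ultimately show ?case unfolding h_def by simp
      qed
    qed measurable
    finally show ?case .
  qed
qed

subsection \<open>Injectivity\<close>

definition ground_state :: "'a::euclidean_space \<Rightarrow> real" where
  "ground_state x = exp (- (norm x)\<^sup>2 / 2)"

lemma ground_state_bounds [simp]: "0 < ground_state x" "0 \<le> ground_state x" "ground_state x \<le> 1"
  by (auto simp: ground_state_def)

lemma borel_measurable_ground_state [measurable]: "ground_state \<in> borel_measurable borel"
  unfolding ground_state_def by measurable

lemma nn_integral_ground_state:
  "(\<integral>\<^sup>+y. ennreal (ground_state y) \<partial>(lborel :: 'a::euclidean_space measure)) = ennreal ((2 * pi) powr (DIM('a) / 2))"
  using nn_integral_exp_quadratic_euclidean[OF zero_less_one, of "0 :: 'a"] by (simp add: ground_state_def)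

lemma integrable_ground_state: "integrable lborel (ground_state :: 'a::euclidean_space \<Rightarrow> real)"
  by (intro integrableI_bounded) (auto simp: nn_integral_ground_state)

lemma nn_integral_mehler_kernel_ground_state_le:
  fixes x :: "'a::euclidean_space"
  assumes "t > 0"
  shows "(\<integral>\<^sup>+y. ennreal (mehler_kernel t x y * ground_state y) \<partial>lborel) \<le> ennreal (exp (- t) * ground_state x)"
proof -
  have "exp (- real DIM('a) * t) \<le> exp (- t)"
    using assms DIM_positive[where 'a = 'a] by (simp add: Suc_le_eq)
  then show ?thesis
    unfolding ground_state_def nn_integral_mehler_kernel_ground_state[OF assms]
    by (intro ennreal_leI mult_right_mono) auto
qed

text \<open>From u \<le> 1 + u^p and the bound 1 on the ground state, the product is dominated by
  the ground state plus the p-th power of the norm of \<open>f\<close>. This avoids conjugate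
  exponents and includes p = 1.\<close>

lemma integrable_ground_state_scaleR:
  fixes f :: "'a::euclidean_space \<Rightarrow> 'b::euclidean_space"
  assumes [measurable]: "f \<in> borel_measurable lborel" and p: "p \<ge> 1" and fp: "integrable lborel (\<lambda>x. norm (f x) powr p)"
  shows "integrable lborel (\<lambda>x. ground_state x *\<^sub>R f x)"
proof (rule Bochner_Integration.integrable_bound)
  show "integrable lborel (\<lambda>x. ground_state x + norm (f x) powr p)"
    by (intro Bochner_Integration.integrable_add integrable_ground_state fp)
  show "AE x in lborel. norm (ground_state x *\<^sub>R f x) \<le> norm (ground_state x + norm (f x) powr p)"
  proof (rule AE_I2)
    fix x
    have "ground_state x * norm (f x) \<le> ground_state x * (1 + norm (f x) powr p)"
      using le_add_powr[of "norm (f x)" 1 p] p by (intro mult_left_mono) auto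
    also have "\<dots> \<le> ground_state x + 1 * norm (f x) powr p"
      unfolding distrib_left by (intro add_mono mult_right_mono) auto
    finally show "norm (ground_state x *\<^sub>R f x) \<le> norm (ground_state x + norm (f x) powr p)"
      by (simp add: abs_of_nonneg add_nonneg_nonneg)
  qed
qed measurable

text \<open>
  These test functions can be paired with \<open>L\<^sup>p\<close> for all \<open>p\<close> at once, and the Mehler semigroup
  preserves them because the ground state is an eigenfunction of it.
\<close>

definition gaussian_bounded :: "real \<Rightarrow> ('a::euclidean_space \<Rightarrow> real) \<Rightarrow> bool" where
  "gaussian_bounded c \<psi> \<longleftrightarrow> \<psi> \<in> borel_measurable borel \<and> (\<forall>x. 0 \<le> \<psi> x \<and> \<psi> x \<le> c * ground_state x)"

text \<open>The operator exp(-tH) on real test functions. Only test functions are evolved, never the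
  \<open>Lp\<close> function paired with them.\<close>

definition mehler :: "real \<Rightarrow> ('a::euclidean_space \<Rightarrow> real) \<Rightarrow> 'a \<Rightarrow> real" where
  "mehler t \<psi> x = (LINT y|lborel. mehler_kernel t x y * \<psi> y)"

lemma gaussian_boundedD:
  assumes "gaussian_bounded c \<psi>"
  shows "\<psi> \<in> borel_measurable borel" "0 \<le> \<psi> x" "\<psi> x \<le> c * ground_state x" "0 \<le> c"
proof -
  show "\<psi> \<in> borel_measurable borel" "0 \<le> \<psi> x" "\<psi> x \<le> c * ground_state x"
    using assms by (auto simp: gaussian_bounded_def)
  have "0 \<le> c * ground_state x"
    using order_trans[OF \<open>0 \<le> \<psi> x\<close> \<open>\<psi> x \<le> c * ground_state x\<close>] .
  then show "0 \<le> c" by (simp add: zero_le_mult_iff ground_state_def)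
qed

lemma borel_measurable_mehler:
  assumes [measurable]: "\<psi> \<in> borel_measurable borel"
  shows "(\<lambda>(t, x). mehler t \<psi> x) \<in> borel_measurable (borel \<Otimes>\<^sub>M borel)"
proof -
  have "(\<lambda>w. LINT y|lborel. mehler_kernel (fst w) (snd w) y * \<psi> y) \<in> borel_measurable (borel \<Otimes>\<^sub>M borel)"
    by measurable
  then show ?thesis by (simp add: mehler_def case_prod_beta)
qed

text \<open>The kernel is nonnegative, so the bound by \<open>c\<close> times the ground state is
  propagated by the eigenvalue relation. The decay \<open>exp (- t)\<close> later gives
  integrability over all times.\<close>

lemma
  assumes \<psi>: "gaussian_bounded c \<psi>" and t: "t > 0"
  shows nn_integral_mehler: "(\<integral>\<^sup>+y. ennreal (mehler_kernel t x y * \<psi> y) \<partial>lborel) = ennreal (mehler t \<psi> x)"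
    and gaussian_bounded_mehler: "gaussian_bounded (c * exp (- t)) (mehler t \<psi>)"
proof -
  note \<psi>D = gaussian_boundedD[OF \<psi>]
  note [measurable] = \<psi>D(1)
  have le: "(\<integral>\<^sup>+y. ennreal (mehler_kernel t x y * \<psi> y) \<partial>lborel) \<le> ennreal (c * exp (- t) * ground_state x)" for x
  proof -
    have "(\<integral>\<^sup>+y. ennreal (mehler_kernel t x y * \<psi> y) \<partial>lborel) \<le> (\<integral>\<^sup>+y. ennreal c * ennreal (mehler_kernel t x y * ground_state y) \<partial>lborel)"
    proof (intro nn_integral_mono)
      fix y
      have "mehler_kernel t x y * \<psi> y \<le> mehler_kernel t x y * (c * ground_state y)"
        by (intro mult_left_mono \<psi>D) auto
      then show "ennreal (mehler_kernel t x y * \<psi> y) \<le> ennreal c * ennreal (mehler_kernel t x y * ground_state y)"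
        using \<psi>D(4) by (simp add: ennreal_mult'[symmetric] ennreal_leI mult_ac)
    qed
    also have "\<dots> \<le> ennreal c * ennreal (exp (- t) * ground_state x)"
      by (subst nn_integral_cmult) (auto intro!: mult_left_mono nn_integral_mehler_kernel_ground_state_le t)
    finally show ?thesis using \<psi>D(4) by (simp add: ennreal_mult'[symmetric] mult_ac)
  qed
  have eq: "(\<integral>\<^sup>+y. ennreal (mehler_kernel t x y * \<psi> y) \<partial>lborel) = ennreal (mehler t \<psi> x)" for x
    unfolding mehler_def using le[of x] \<psi>D(2)
    by (intro nn_integral_eq_integral integrableI_bounded) (auto simp: less_top[symmetric] top_unique)
  then show "(\<integral>\<^sup>+y. ennreal (mehler_kernel t x y * \<psi> y) \<partial>lborel) = ennreal (mehler t \<psi> x)" .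
  have "0 \<le> mehler t \<psi> x" for x
    unfolding mehler_def by (intro integral_nonneg_AE AE_I2 mult_nonneg_nonneg \<psi>D) auto
  moreover have "mehler t \<psi> x \<le> c * exp (- t) * ground_state x" for x
    using le[of x] \<psi>D(4) unfolding eq by (simp add: ennreal_le_iff)
  ultimately show "gaussian_bounded (c * exp (- t)) (mehler t \<psi>)"
    unfolding gaussian_bounded_def
    using borel_measurable_mehler[OF \<psi>D(1)] by (auto intro: measurable_compose[OF measurable_Pair1'])
qed

text \<open>Tonelli reduces this to the semigroup law of the kernels; nonnegativity of both sides
  allows the return from extended to real values.\<close>

lemma mehler_mehler:
  assumes \<psi>: "gaussian_bounded c \<psi>" and t: "t > 0" and r: "r > 0"
  shows "mehler t (mehler r \<psi>) x = mehler (t + r) \<psi> x"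
proof -
  note [measurable] = gaussian_boundedD(1)[OF \<psi>] and \<psi>0 = gaussian_boundedD(2)[OF \<psi>]
  have tr: "t + r > 0" using t r by simp
  note r\<psi> = gaussian_bounded_mehler[OF \<psi> r]
  have "ennreal (mehler t (mehler r \<psi>) x) = (\<integral>\<^sup>+z. ennreal (mehler_kernel t x z) * ennreal (mehler r \<psi> z) \<partial>lborel)"
    using nn_integral_mehler[OF r\<psi> t, of x] by (simp add: ennreal_mult')
  also have "\<dots> = (\<integral>\<^sup>+z. \<integral>\<^sup>+y. ennreal (mehler_kernel t x z) * ennreal (mehler_kernel r z y) * ennreal (\<psi> y) \<partial>lborel \<partial>lborel)"
    by (simp add: nn_integral_mehler[OF \<psi> r, symmetric] nn_integral_cmult[symmetric] ennreal_mult' mult.assoc)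
  also have "\<dots> = (\<integral>\<^sup>+y. \<integral>\<^sup>+z. ennreal (mehler_kernel t x z) * ennreal (mehler_kernel r z y) * ennreal (\<psi> y) \<partial>lborel \<partial>lborel)"
    by (rule lborel_pair.Fubini') measurable
  also have "\<dots> = (\<integral>\<^sup>+y. ennreal (mehler_kernel (t + r) x y) * ennreal (\<psi> y) \<partial>lborel)"
    by (simp add: nn_integral_multc nn_integral_mehler_kernel_mult[OF t r])
  also have "\<dots> = ennreal (mehler (t + r) \<psi> x)"
    by (simp add: nn_integral_mehler[OF \<psi> tr, symmetric] ennreal_mult')
  finally show ?thesis
    using gaussian_boundedD(2)[OF gaussian_bounded_mehler[OF r\<psi> t]]
      gaussian_boundedD(2)[OF gaussian_bounded_mehler[OF \<psi> tr]] by simp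
qed

text \<open>The ground state times \<open>f\<close> serves as majorant. The second bound is linear
  in \<open>c\<close>, so it inherits the decay in time of \<open>mehler t \<psi>\<close>.\<close>

lemma integrable_gaussian_bounded_scaleR:
  fixes f :: "'a::euclidean_space \<Rightarrow> 'b::euclidean_space"
  assumes \<psi>: "gaussian_bounded c \<psi>" and [measurable]: "f \<in> borel_measurable lborel"
    and fW: "integrable lborel (\<lambda>x. ground_state x *\<^sub>R f x)"
  shows "integrable lborel (\<lambda>x. \<psi> x *\<^sub>R f x)"
    and "(\<integral>\<^sup>+x. ennreal (norm (\<psi> x *\<^sub>R f x)) \<partial>lborel) \<le> ennreal (c * (LINT x|lborel. norm (ground_state x *\<^sub>R f x)))"
proof -
  note \<psi>D = gaussian_boundedD[OF \<psi>]
  note [measurable] = \<psi>D(1)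
  have int: "integrable lborel (\<lambda>x. c * norm (ground_state x *\<^sub>R f x))"
    using integrable_norm[OF fW] by simp
  have le: "norm (\<psi> x *\<^sub>R f x) \<le> c * norm (ground_state x *\<^sub>R f x)" for x
    using \<psi>D(2,3)[of x] by (simp add: mult_right_mono flip: mult.assoc)
  show "integrable lborel (\<lambda>x. \<psi> x *\<^sub>R f x)"
    by (rule Bochner_Integration.integrable_bound[OF int])
      (use le in \<open>auto intro!: AE_I2 intro: order_trans[OF _ abs_ge_self]\<close>)
  have "(\<integral>\<^sup>+x. ennreal (norm (\<psi> x *\<^sub>R f x)) \<partial>lborel) \<le> (\<integral>\<^sup>+x. ennreal (c * norm (ground_state x *\<^sub>R f x)) \<partial>lborel)"
    using le by (intro nn_integral_mono ennreal_leI)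
  also have "\<dots> = ennreal (LINT x|lborel. c * norm (ground_state x *\<^sub>R f x))"
    using \<psi>D(4) by (intro nn_integral_eq_integral int) auto
  finally show "(\<integral>\<^sup>+x. ennreal (norm (\<psi> x *\<^sub>R f x)) \<partial>lborel) \<le> ennreal (c * (LINT x|lborel. norm (ground_state x *\<^sub>R f x)))"
    by simp
qed

section \<open>Pairing the semigroup with a function in the kernel of H^(-1)\<close>

text \<open>For s = 1 the gamma weight is the indicator of the positive times, so H^(-1) is the
  plain time integral of the semigroup. Symmetry of the kernel permits integration in its first
  argument.\<close>

lemma nn_integral_potential_kernel_one:
  assumes \<psi>: "gaussian_bounded c \<psi>"
  shows "(\<integral>\<^sup>+x. ennreal (potential_kernel 1 x y * \<psi> x) \<partial>lborel) =
    (\<integral>\<^sup>+t. ennreal (indicator {0<..} t * mehler t \<psi> y) \<partial>lborel)"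
proof -
  note [measurable] = gaussian_boundedD(1)[OF \<psi>]
  have "AE x in lborel. ennreal (potential_kernel 1 x y * \<psi> x) = nn_potential_kernel 1 y x * ennreal (\<psi> x)"
    using AE_potential_kernel[OF zero_less_one, of y]
    by eventually_elim (simp add: ennreal_mult' potential_kernel_nonneg potential_kernel_commute[of 1 _ y])
  then have "(\<integral>\<^sup>+x. ennreal (potential_kernel 1 x y * \<psi> x) \<partial>lborel) = (\<integral>\<^sup>+x. nn_potential_kernel 1 y x * ennreal (\<psi> x) \<partial>lborel)"
    by (rule nn_integral_cong_AE)
  also have "\<dots> = (\<integral>\<^sup>+x. \<integral>\<^sup>+t. gamma_weight 1 t * ennreal (mehler_kernel t y x * \<psi> x) \<partial>lborel \<partial>lborel)"
    unfolding nn_potential_kernel_def by (simp add: nn_integral_multc[symmetric] ennreal_mult' mult.assoc)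
  also have "\<dots> = (\<integral>\<^sup>+t. \<integral>\<^sup>+x. gamma_weight 1 t * ennreal (mehler_kernel t y x * \<psi> x) \<partial>lborel \<partial>lborel)"
    by (rule lborel_pair.Fubini') measurable
  also have "\<dots> = (\<integral>\<^sup>+t. ennreal (indicator {0<..} t * mehler t \<psi> y) \<partial>lborel)"
  proof (rule nn_integral_cong)
    fix t :: real
    show "(\<integral>\<^sup>+x. gamma_weight 1 t * ennreal (mehler_kernel t y x * \<psi> x) \<partial>lborel) = ennreal (indicator {0<..} t * mehler t \<psi> y)"
      using nn_integral_mehler[OF \<psi>, of t y]
      by (cases "t > 0") (auto simp: gamma_weight_def nn_integral_cmult)
  qed
  finally show ?thesis .
qed

definition mehler_pairing :: "('a::euclidean_space \<Rightarrow> 'k::euclidean_space) \<Rightarrow> ('a \<Rightarrow> real) \<Rightarrow> real \<Rightarrow> 'k" where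
  "mehler_pairing f \<psi> t = (LINT x|lborel. mehler t \<psi> x *\<^sub>R f x)"

text \<open>Writing <.,.> for the pairing, Fubini gives: the integral of <f, exp(-tH) \<psi>> over
  positive t is <f, H^(-1) \<psi>>, which is <H^(-1) f, \<psi>> by a second Fubini exchange, and
  this is 0.\<close>

lemma
  fixes f :: "'a::euclidean_space \<Rightarrow> 'k::euclidean_space"
  assumes \<psi>: "gaussian_bounded c \<psi>" and p: "p \<ge> 1"
    and f [measurable]: "f \<in> borel_measurable lborel" and fp: "integrable lborel (\<lambda>x. norm (f x) powr p)"
    and null: "AE x in lborel. potential 1 f x = 0"
  shows integrable_mehler_pairing: "integrable lborel (\<lambda>t. indicator {0<..} t *\<^sub>R mehler_pairing f \<psi> t)"
    and integral_mehler_pairing: "(LINT t|lborel. indicator {0<..} t *\<^sub>R mehler_pairing f \<psi> t) = 0"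
proof -
  note \<psi>D = gaussian_boundedD[OF \<psi>]
  note [measurable] = \<psi>D(1)
  note fW = integrable_ground_state_scaleR[OF f p fp]
  have mehler_meas [measurable]: "(\<lambda>w. mehler (g w) \<psi> (h w)) \<in> borel_measurable M"
    if [measurable]: "g \<in> borel_measurable M" "h \<in> M \<rightarrow>\<^sub>M borel" for g :: "'w \<Rightarrow> real" and h :: "'w \<Rightarrow> 'a" and M
    using measurable_compose[OF _ borel_measurable_mehler[OF \<psi>D(1)], of "\<lambda>w. (g w, h w)" M] by simp
  define A where "A = (LINT x|lborel. norm (ground_state x *\<^sub>R f x))"
  have A: "A \<ge> 0" unfolding A_def by (intro integral_nonneg_AE) auto
  define h where "h t x = (indicator {0<..} t * mehler t \<psi> x) *\<^sub>R f x" for t x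
  have [measurable]: "(\<lambda>(t, x). h t x) \<in> borel_measurable (lborel \<Otimes>\<^sub>M lborel)"
    unfolding h_def by measurable
  have m0: "indicator {0<..} t * mehler t \<psi> x \<ge> 0" for t x
    using gaussian_boundedD(2)[OF gaussian_bounded_mehler[OF \<psi>, of t]] by (auto simp: indicator_def)
  have "(\<integral>\<^sup>+w. ennreal (norm (case_prod h w)) \<partial>(lborel \<Otimes>\<^sub>M lborel)) =
      (\<integral>\<^sup>+t. \<integral>\<^sup>+x. ennreal (norm (h t x)) \<partial>lborel \<partial>lborel)"
    by (subst lborel.nn_integral_fst[symmetric]) auto
  also have "\<dots> \<le> (\<integral>\<^sup>+t. ennreal (c * A) * (gamma_weight 1 t * ennreal (exp (- t))) \<partial>lborel)"
  proof (rule nn_integral_mono)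
    fix t :: real
    show "(\<integral>\<^sup>+x. ennreal (norm (h t x)) \<partial>lborel) \<le> ennreal (c * A) * (gamma_weight 1 t * ennreal (exp (- t)))"
    proof (cases "t > 0")
      case True
      then show ?thesis
        using integrable_gaussian_bounded_scaleR(2)[OF gaussian_bounded_mehler[OF \<psi> True] f fW] \<psi>D(4) A
        by (simp add: h_def gamma_weight_def A_def ennreal_mult'[symmetric] mult_ac)
    qed (simp add: h_def)
  qed
  also have "\<dots> = ennreal (c * A)"
    by (simp add: nn_integral_cmult nn_integral_gamma_weight_exp)
  also have "\<dots> < \<infinity>" by simp
  finally have int: "integrable (lborel \<Otimes>\<^sub>M lborel) (case_prod h)"
    by (intro integrableI_bounded) auto
  have h1: "(LINT x|lborel. h t x) = indicator {0<..} t *\<^sub>R mehler_pairing f \<psi> t" for t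
    unfolding mehler_pairing_def h_def by (simp flip: scaleR_scaleR)
  show "integrable lborel (\<lambda>t. indicator {0<..} t *\<^sub>R mehler_pairing f \<psi> t)"
    using lborel_pair.integrable_fst[OF int] by (simp add: h1)
  \<comment> \<open>The integrand of <H^(-1) f, \<psi>>, while \<open>h\<close> is that of the time
    integral of the pairing. Their absolute integrals over the inner variable agree at every
    \<open>y\<close>, so \<open>k\<close> inherits integrability from \<open>h\<close>.\<close>
  define k where "k x y = (potential_kernel 1 x y * \<psi> x) *\<^sub>R f y" for x y
  have [measurable]: "(\<lambda>(x, y). k x y) \<in> borel_measurable (lborel \<Otimes>\<^sub>M lborel)"
    unfolding k_def by measurable
  have k0: "potential_kernel 1 x y * \<psi> x \<ge> 0" for x y
    using \<psi>D(2) by (simp add: potential_kernel_nonneg)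
  have hk: "(\<integral>\<^sup>+x. ennreal (norm (k x y)) \<partial>lborel) = (\<integral>\<^sup>+t. ennreal (norm (h t y)) \<partial>lborel)" for y
    unfolding k_def h_def using k0 m0 nn_integral_potential_kernel_one[OF \<psi>, of y]
    by (simp add: ennreal_mult' nn_integral_multc)
  have "(\<integral>\<^sup>+w. ennreal (norm (case_prod k w)) \<partial>(lborel \<Otimes>\<^sub>M lborel)) =
      (\<integral>\<^sup>+y. \<integral>\<^sup>+x. ennreal (norm (k x y)) \<partial>lborel \<partial>lborel)"
    by (subst lborel_pair.nn_integral_snd[symmetric]) auto
  also have "\<dots> = (\<integral>\<^sup>+w. ennreal (norm (case_prod h w)) \<partial>(lborel \<Otimes>\<^sub>M lborel))"
    unfolding hk by (subst lborel_pair.nn_integral_snd[symmetric]) auto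
  also have "\<dots> < \<infinity>" using int by (simp add: integrable_iff_bounded)
  finally have intk: "integrable (lborel \<Otimes>\<^sub>M lborel) (case_prod k)"
    by (intro integrableI_bounded) auto
  have "(LINT t|lborel. indicator {0<..} t *\<^sub>R mehler_pairing f \<psi> t) = (LINT y|lborel. LINT t|lborel. h t y)"
    unfolding h1[symmetric] using lborel_pair.Fubini_integral[OF int] by simp
  also have "\<dots> = (LINT y|lborel. LINT x|lborel. k x y)"
  proof (rule Bochner_Integration.integral_cong[OF refl])
    fix y
    \<comment> \<open>The bound \<open>c * exp (- t)\<close> makes both scalar integrals finite at
      every \<open>y\<close>, so they can be compared as real numbers before multiplying by
      \<open>f y\<close>.\<close>
    have "(\<integral>\<^sup>+t. ennreal (indicator {0<..} t * mehler t \<psi> y) \<partial>lborel) \<le>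
        (\<integral>\<^sup>+t. ennreal c * (gamma_weight 1 t * ennreal (exp (- t))) \<partial>lborel)"
    proof (rule nn_integral_mono)
      fix t :: real
      show "ennreal (indicator {0<..} t * mehler t \<psi> y) \<le> ennreal c * (gamma_weight 1 t * ennreal (exp (- t)))"
      proof (cases "t > 0")
        case True
        have "mehler t \<psi> y \<le> c * exp (- t) * ground_state y"
          by (rule gaussian_boundedD(3)[OF gaussian_bounded_mehler[OF \<psi> True]])
        also have "\<dots> \<le> c * exp (- t)"
          using \<psi>D(4) by (intro mult_left_le) auto
        finally show ?thesis
          using True \<psi>D(4) by (simp add: gamma_weight_def ennreal_mult'[symmetric] ennreal_leI)
      qed simp
    qed
    also have "\<dots> < \<infinity>"
      by (simp add: nn_integral_cmult nn_integral_gamma_weight_exp)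
    finally have fin: "integrable lborel (\<lambda>t. indicator {0<..} t * mehler t \<psi> y)"
        "integrable lborel (\<lambda>x. potential_kernel 1 x y * \<psi> x)"
      using m0 k0 nn_integral_potential_kernel_one[OF \<psi>, of y] by (auto intro!: integrableI_bounded)
    have "(LINT x|lborel. potential_kernel 1 x y * \<psi> x) = (LINT t|lborel. indicator {0<..} t * mehler t \<psi> y)"
      using k0 m0 nn_integral_potential_kernel_one[OF \<psi>, of y]
      by (subst (1 2) integral_eq_nn_integral) auto
    then show "(LINT t|lborel. h t y) = (LINT x|lborel. k x y)"
      using fin by (simp add: h_def k_def)
  qed
  also have "\<dots> = (LINT x|lborel. LINT y|lborel. k x y)"
    using lborel_pair.Fubini_integral[OF intk] by simp
  also have "\<dots> = (LINT x|lborel. \<psi> x *\<^sub>R potential 1 f x)"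
    unfolding k_def potential_def by (simp add: mult.commute[of _ "\<psi> _"] flip: scaleR_scaleR)
  also have "\<dots> = 0"
    using null by (intro integral_eq_zero_AE, eventually_elim) simp
  finally show "(LINT t|lborel. indicator {0<..} t *\<^sub>R mehler_pairing f \<psi> t) = 0" .
qed

text \<open>The substitution turns the kernel into a fixed Gaussian, which makes dominated convergence applicable as \<open>t \<rightarrow> 0\<close>.\<close>

lemma mehler_substitution:
  fixes x :: "'a::euclidean_space"
  assumes t: "t > 0" and [measurable]: "\<psi> \<in> borel_measurable borel"
  shows "mehler t \<psi> x = cosh (2 * t) powr (- real DIM('a) / 2) * exp (- tanh (2 * t) / 2 * (norm x)\<^sup>2) *
    (LINT z|lborel. (2 * pi) powr (- real DIM('a) / 2) * ground_state z * \<psi> (x /\<^sub>R cosh (2 * t) + sqrt (tanh (2 * t)) *\<^sub>R z))"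
proof -
  define S C where "S = sinh (2 * t)" and "C = cosh (2 * t)"
  have pos: "S > 0" "C > 0" using t by (auto simp: S_def C_def)
  have sq: "C\<^sup>2 = 1 + S\<^sup>2" using cosh_square_eq[of "2 * t"] by (simp add: S_def C_def)
  \<comment> \<open>As a function of \<open>y\<close> the Mehler kernel is proportional to a
    Gaussian with mean x / cosh 2t and variance tanh 2t in each coordinate; \<open>c\<close> is its
    standard deviation.\<close>
  define c where "c = sqrt (S / C)"
  have c: "c > 0" "c\<^sup>2 = S / C" using pos by (auto simp: c_def)
  have th: "tanh (2 * t) = S / C" by (simp add: tanh_def S_def C_def)
  have "mehler t \<psi> x = c ^ DIM('a) * (LINT z|lborel. mehler_kernel t x (x /\<^sub>R C + c *\<^sub>R z) * \<psi> (x /\<^sub>R C + c *\<^sub>R z))"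
    unfolding mehler_def using c
    by (subst lborel_affine[of c "x /\<^sub>R C"]) (simp_all add: integral_density integral_distr)
  also have "\<dots> = (LINT z|lborel. c ^ DIM('a) * (mehler_kernel t x (x /\<^sub>R C + c *\<^sub>R z) * \<psi> (x /\<^sub>R C + c *\<^sub>R z)))"
    by simp
  also have "\<dots> = (LINT z|lborel. C powr (- real DIM('a) / 2) * exp (- (S / C) / 2 * (norm x)\<^sup>2) *
      ((2 * pi) powr (- real DIM('a) / 2) * ground_state z * \<psi> (x /\<^sub>R C + c *\<^sub>R z)))"
  proof (rule Bochner_Integration.integral_cong[OF refl])
    fix z :: 'a
    have "(norm (x /\<^sub>R C + c *\<^sub>R z))\<^sup>2 = (norm x)\<^sup>2 / C\<^sup>2 + 2 * (c / C) * (x \<bullet> z) + c\<^sup>2 * (norm z)\<^sup>2"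
      unfolding power2_norm_eq_inner
      by (simp add: inner_add_left inner_add_right inner_commute power2_eq_square field_simps)
    moreover have "x \<bullet> (x /\<^sub>R C + c *\<^sub>R z) = (norm x)\<^sup>2 / C + c * (x \<bullet> z)"
      by (simp add: inner_add_right power2_norm_eq_inner divide_inverse_commute)
    moreover have "- (C / S) / 2 * (X + (X / C\<^sup>2 + 2 * (c / C) * i + c\<^sup>2 * Z)) + (X / C + c * i) / S =
        - (S / C) / 2 * X + - Z / 2" for X Z i :: real
    proof -
      have "- (C / S) / 2 * (X + (X / C\<^sup>2 + 2 * (c / C) * i + c\<^sup>2 * Z)) + (X / C + c * i) / S =
          - X / 2 * ((C\<^sup>2 - 1) / (C * S)) - c\<^sup>2 * (C / S) * Z / 2"
        using pos by (simp add: field_simps power2_eq_square)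
      also have "C\<^sup>2 - 1 = S * S" by (simp add: sq) (simp add: power2_eq_square)
      also have "S * S / (C * S) = S / C" using pos by simp
      also have "c\<^sup>2 * (C / S) = 1" using pos by (simp add: c)
      finally show ?thesis by (simp add: mult.commute)
    qed
    ultimately have e: "- (C / S) / 2 * ((norm x)\<^sup>2 + (norm (x /\<^sub>R C + c *\<^sub>R z))\<^sup>2) + x \<bullet> (x /\<^sub>R C + c *\<^sub>R z) / S =
        - (S / C) / 2 * (norm x)\<^sup>2 + - (norm z)\<^sup>2 / 2"
      by presburger
    have "c ^ DIM('a) = (S / C) powr (DIM('a) / 2)"
      using pos by (simp add: c_def powr_half_sqrt[symmetric] powr_powr powr_realpow[symmetric])
    then have "c ^ DIM('a) * (2 * pi * S) powr (- real DIM('a) / 2) =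
        C powr (- real DIM('a) / 2) * (2 * pi) powr (- real DIM('a) / 2)"
      using pos by (simp add: powr_mult powr_divide powr_minus field_simps)
    then show "c ^ DIM('a) * (mehler_kernel t x (x /\<^sub>R C + c *\<^sub>R z) * \<psi> (x /\<^sub>R C + c *\<^sub>R z)) =
      C powr (- real DIM('a) / 2) * exp (- (S / C) / 2 * (norm x)\<^sup>2) *
      ((2 * pi) powr (- real DIM('a) / 2) * ground_state z * \<psi> (x /\<^sub>R C + c *\<^sub>R z))"
      unfolding mehler_kernel_eq[OF t] S_def[symmetric] C_def[symmetric] e exp_add ground_state_def
      by (simp only: mult.assoc[symmetric]) (simp only: mult_ac)
  qed
  finally show ?thesis unfolding th c_def C_def[symmetric] by simp
qed

section \<open>Convergence as t tends to 0\<close>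

text \<open>In the substituted form the prefactor tends to 1 and the argument of
  \<open>\<psi>\<close> tends to \<open>x\<close>, since cosh 2t tends to 1 and tanh 2t to 0. The
  fixed Gaussian has mass 1, and \<open>B\<close> times it dominates the integrand.\<close>

lemma tendsto_mehler:
  fixes x :: "'a::euclidean_space"
  assumes [measurable]: "\<psi> \<in> borel_measurable borel" and bound: "\<And>y. \<bar>\<psi> y\<bar> \<le> B" and cont: "isCont \<psi> x"
  shows "((\<lambda>t. mehler t \<psi> x) \<longlongrightarrow> \<psi> x) (at_right 0)"
  unfolding tendsto_at_iff_sequentially
proof (intro allI impI)
  fix X :: "nat \<Rightarrow> real"
  assume X: "\<forall>i. X i \<in> {0<..} - {0}" "X \<longlonglongrightarrow> 0"
  have I: "(LINT z|lborel. (2 * pi) powr (- real DIM('a) / 2) * ground_state (z::'a)) = 1"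
  proof -
    have "ennreal (LINT z|lborel. ground_state (z::'a)) = ennreal ((2 * pi) powr (DIM('a) / 2))"
      unfolding nn_integral_ground_state[symmetric]
      by (intro nn_integral_eq_integral[symmetric] integrable_ground_state) auto
    then have "(LINT z|lborel. ground_state (z::'a)) = (2 * pi) powr (DIM('a) / 2)"
      by (subst (asm) ennreal_inj) (auto intro!: integral_nonneg_AE)
    then show ?thesis by (simp add: powr_minus)
  qed
  have a: "(\<lambda>n. x /\<^sub>R cosh (2 * X n) + sqrt (tanh (2 * X n)) *\<^sub>R z) \<longlonglongrightarrow> x" for z
  proof -
    have "(\<lambda>n. x /\<^sub>R cosh (2 * X n) + sqrt (tanh (2 * X n)) *\<^sub>R z) \<longlonglongrightarrow> x /\<^sub>R cosh (2 * 0) + sqrt (tanh (2 * 0)) *\<^sub>R z"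
      by (intro tendsto_intros X(2)) auto
    then show ?thesis by simp
  qed
  have "(\<lambda>n. LINT z|lborel. (2 * pi) powr (- real DIM('a) / 2) * ground_state z * \<psi> (x /\<^sub>R cosh (2 * X n) + sqrt (tanh (2 * X n)) *\<^sub>R z))
    \<longlonglongrightarrow> (LINT z|lborel. (2 * pi) powr (- real DIM('a) / 2) * ground_state (z::'a) * \<psi> x)"
  proof (rule integral_dominated_convergence)
    show "integrable lborel (\<lambda>z::'a. (2 * pi) powr (- real DIM('a) / 2) * ground_state z * B)"
      by (intro integrable_mult_left integrable_mult_right integrable_ground_state)
    show "AE z in lborel. (\<lambda>n. (2 * pi) powr (- real DIM('a) / 2) * ground_state z * \<psi> (x /\<^sub>R cosh (2 * X n) + sqrt (tanh (2 * X n)) *\<^sub>R z))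
      \<longlonglongrightarrow> (2 * pi) powr (- real DIM('a) / 2) * ground_state z * \<psi> x"
      using isCont_tendsto_compose[OF cont a] by (intro AE_I2 tendsto_mult_left)
    show "AE z in lborel. norm ((2 * pi) powr (- real DIM('a) / 2) * ground_state z *
        \<psi> (x /\<^sub>R cosh (2 * X n) + sqrt (tanh (2 * X n)) *\<^sub>R z)) \<le> (2 * pi) powr (- real DIM('a) / 2) * ground_state z * B" for n
      using bound by (intro AE_I2) (simp add: abs_mult mult_left_mono)
  qed measurable
  moreover have "(\<lambda>n. cosh (2 * X n) powr (- real DIM('a) / 2) * exp (- tanh (2 * X n) / 2 * (norm x)\<^sup>2))
    \<longlonglongrightarrow> cosh (2 * 0) powr (- real DIM('a) / 2) * exp (- tanh (2 * 0) / 2 * (norm x)\<^sup>2)"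
    by (intro tendsto_intros X(2)) auto
  ultimately have lim: "(\<lambda>n. cosh (2 * X n) powr (- real DIM('a) / 2) * exp (- tanh (2 * X n) / 2 * (norm x)\<^sup>2) *
    (LINT z|lborel. (2 * pi) powr (- real DIM('a) / 2) * ground_state z * \<psi> (x /\<^sub>R cosh (2 * X n) + sqrt (tanh (2 * X n)) *\<^sub>R z)))
    \<longlonglongrightarrow> cosh (2 * 0) powr (- real DIM('a) / 2) * exp (- tanh (2 * 0) / 2 * (norm x)\<^sup>2) *
      (LINT z|lborel. (2 * pi) powr (- real DIM('a) / 2) * ground_state (z::'a) * \<psi> x)"
    by (rule tendsto_mult[rotated])
  have J: "(LINT z|lborel. (2 * pi) powr (- real DIM('a) / 2) * ground_state (z::'a) * \<psi> x) = \<psi> x"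
    using integral_mult_left_zero[of lborel "\<lambda>z::'a. (2 * pi) powr (- real DIM('a) / 2) * ground_state z" "\<psi> x"]
    unfolding I by simp
  have M: "mehler (X n) \<psi> x = cosh (2 * X n) powr (- real DIM('a) / 2) * exp (- tanh (2 * X n) / 2 * (norm x)\<^sup>2) *
    (LINT z|lborel. (2 * pi) powr (- real DIM('a) / 2) * ground_state z * \<psi> (x /\<^sub>R cosh (2 * X n) + sqrt (tanh (2 * X n)) *\<^sub>R z))" for n
    using X(1) by (intro mehler_substitution) auto
  show "((\<lambda>t. mehler t \<psi> x) \<circ> X) \<longlonglongrightarrow> \<psi> x"
    using lim unfolding J M comp_def by simp
qed

text \<open>A box lies in a ball of some radius \<open>R\<close>, on which the ground state is at
  least exp(-R^2 / 2).\<close>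

lemma gaussian_bounded_indicator_box:
  "\<exists>c. gaussian_bounded c (indicator (box u v :: 'a::euclidean_space set))"
proof -
  obtain R where R: "\<And>x. x \<in> box u v \<Longrightarrow> norm x \<le> R"
    using bounded_box[of u v] by (auto simp: bounded_iff)
  have "indicator (box u v) x \<le> exp (R\<^sup>2 / 2) * ground_state x" for x
  proof (cases "x \<in> box u v")
    case True
    then have "(norm x)\<^sup>2 \<le> R\<^sup>2" using R by (intro power_mono) auto
    then show ?thesis using True by (simp add: ground_state_def flip: exp_add)
  qed simp
  then show ?thesis unfolding gaussian_bounded_def by (intro exI[of _ "exp (R\<^sup>2 / 2)"]) auto
qed

text \<open>The indicator is continuous off the frontier of the box, so its evolution converges
  there pointwise. As exp(-t) \<le> 1, one multiple of the ground state bounds the evolved indicator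
  at all times, which gives domination.\<close>

lemma tendsto_mehler_pairing:
  fixes f :: "'a::euclidean_space \<Rightarrow> 'k::euclidean_space"
  assumes f [measurable]: "f \<in> borel_measurable lborel"
    and fW: "integrable lborel (\<lambda>x. ground_state x *\<^sub>R f x)"
  shows "(mehler_pairing f (indicator (box u v)) \<longlongrightarrow> (LINT x|lborel. indicator (box u v) x *\<^sub>R f x)) (at_right 0)"
  unfolding tendsto_at_iff_sequentially
proof (intro allI impI)
  fix X :: "nat \<Rightarrow> real"
  assume X: "\<forall>i. X i \<in> {0<..} - {0}" "X \<longlonglongrightarrow> 0"
  obtain c where \<psi>: "gaussian_bounded c (indicator (box u v) :: 'a \<Rightarrow> real)" 
    using gaussian_bounded_indicator_box by blast
  note c = gaussian_boundedD(4)[OF \<psi>]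
  have X': "filterlim X (at_right 0) sequentially"
    using X by (simp add: filterlim_at less_imp_neq[symmetric])
  have m: "gaussian_bounded (c * exp (- X n)) (mehler (X n) (indicator (box u v) :: 'a \<Rightarrow> real))" for n
    using X(1) by (intro gaussian_bounded_mehler \<psi>) auto
  have [measurable]: "mehler (X n) (indicator (box u v) :: 'a \<Rightarrow> real) \<in> borel_measurable borel" for n
    by (rule gaussian_boundedD(1)[OF m])
  \<comment> \<open>This set contains every discontinuity of the indicator.\<close>
  have "negligible (cbox u v - box u v)"
    by (rule negligible_frontier_interval)
  then have "cbox u v - box u v \<in> null_sets lborel"
    unfolding negligible_iff_null_sets by (subst (asm) null_sets_completion_iff) auto
  then have "AE x in lborel. x \<notin> cbox u v - box u v"
    by (rule AE_not_in)
  then have lim: "AE x in lborel. (\<lambda>n. mehler (X n) (indicator (box u v)) x *\<^sub>R f x) \<longlonglongrightarrow> indicator (box u v) x *\<^sub>R f x"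
  proof eventually_elim
    case (elim x)
    have "isCont (indicator (box u v) :: 'a \<Rightarrow> real) x"
    proof (cases "x \<in> box u v")
      case True
      then have "eventually (\<lambda>y. y \<in> box u v) (nhds x)"
        by (intro eventually_nhds_in_open open_box)
      then have "eventually (\<lambda>y. indicator (box u v) y = (1::real)) (nhds x)"
        by (rule eventually_mono) auto
      then show ?thesis using isCont_cong[of _ "\<lambda>_. 1"] by auto
    next
      case False
      with elim have "x \<in> - cbox u v" by auto
      then have "eventually (\<lambda>y. y \<in> - cbox u v) (nhds x)"
        by (intro eventually_nhds_in_open) (auto simp: closed_cbox)
      then have "eventually (\<lambda>y. indicator (box u v) y = (0::real)) (nhds x)"
        by (rule eventually_mono) (use box_subset_cbox[of u v] in \<open>auto simp: indicator_def\<close>)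
      then show ?thesis using isCont_cong[of _ "\<lambda>_. 0"] by auto
    qed
    then have "((\<lambda>t. mehler t (indicator (box u v)) x) \<longlongrightarrow> indicator (box u v) x) (at_right 0)"
      by (intro tendsto_mehler[where B = 1]) (auto simp: indicator_def)
    then have "(\<lambda>n. mehler (X n) (indicator (box u v)) x) \<longlonglongrightarrow> indicator (box u v) x"
      using X' by (rule filterlim_compose)
    then show ?case by (intro tendsto_intros)
  qed
  show "(mehler_pairing f (indicator (box u v)) \<circ> X) \<longlonglongrightarrow> (LINT x|lborel. indicator (box u v) x *\<^sub>R f x)"
    unfolding comp_def mehler_pairing_def
  proof (rule integral_dominated_convergence[OF _ _ _ lim])
    show "integrable lborel (\<lambda>x. c * norm (ground_state x *\<^sub>R f x))"
      using integrable_norm[OF fW] by simp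
    show "AE x in lborel. norm (mehler (X n) (indicator (box u v)) x *\<^sub>R f x) \<le> c * norm (ground_state x *\<^sub>R f x)" for n
    proof (rule AE_I2)
      fix x
      have "mehler (X n) (indicator (box u v)) x \<le> c * exp (- X n) * ground_state x"
        by (rule gaussian_boundedD(3)[OF m])
      also have "\<dots> \<le> c * 1 * ground_state x"
        using X(1) c by (intro mult_right_mono mult_left_mono) (auto simp: less_imp_le)
      finally have "mehler (X n) (indicator (box u v)) x * norm (f x) \<le> c * ground_state x * norm (f x)"
        by (intro mult_right_mono) auto
      then show "norm (mehler (X n) (indicator (box u v)) x *\<^sub>R f x) \<le> c * norm (ground_state x *\<^sub>R f x)"
        using gaussian_boundedD(2)[OF m] by simp
    qed
  qed measurable
qed

text \<open>The pairing \<open>F\<close> integrates to 0 over all positive times and also over times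
  beyond any \<open>r\<close>, hence over (0, r]. For small \<open>r\<close> this is incompatible
  with \<open>F\<close> being close to a nonzero limit \<open>L\<close> at 0.\<close>

lemma integral_box_eq_0:
  fixes f :: "'a::euclidean_space \<Rightarrow> 'k::euclidean_space"
  assumes p: "p \<ge> 1" and f [measurable]: "f \<in> borel_measurable lborel"
    and fp: "integrable lborel (\<lambda>x. norm (f x) powr p)"
    and null: "AE x in lborel. potential 1 f x = 0"
  shows "(LINT x|lborel. indicator (box u v) x *\<^sub>R f x) = 0"
proof (rule ccontr)
  define L where "L = (LINT x|lborel. indicator (box u v) x *\<^sub>R f x)"
  assume "(LINT x|lborel. indicator (box u v) x *\<^sub>R f x) \<noteq> 0"
  then have L: "norm L / 2 > 0" by (simp add: L_def)
  define F where "F = mehler_pairing f (indicator (box u v))"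
  obtain c where \<psi>: "gaussian_bounded c (indicator (box u v) :: 'a \<Rightarrow> real)" 
    using gaussian_bounded_indicator_box by blast
  note fW = integrable_ground_state_scaleR[OF f p fp]
  have "(F \<longlongrightarrow> L) (at_right 0)"
    unfolding F_def L_def by (rule tendsto_mehler_pairing[OF f fW])
  from tendstoD[OF this L] obtain r where r: "r > 0" "\<And>t. 0 < t \<Longrightarrow> t < r \<Longrightarrow> dist (F t) L < norm L / 2"
    by (auto simp: eventually_at_right_field)
  have int: "integrable lborel (\<lambda>t. indicator {0<..} t *\<^sub>R F t)" and I: "(LINT t|lborel. indicator {0<..} t *\<^sub>R F t) = 0"
    unfolding F_def using integrable_mehler_pairing[OF \<psi> p f fp null] integral_mehler_pairing[OF \<psi> p f fp null] by auto
  \<comment> \<open>Evolving the test function by \<open>r\<close> beforehand shifts time by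
    \<open>r\<close>. The form \<open>r + 1 * t\<close> fits the affine change of variable
    below.\<close>
  have F': "indicator {0<..} t *\<^sub>R mehler_pairing f (mehler r (indicator (box u v))) t = indicator {r<..} (r + 1 * t) *\<^sub>R F (r + 1 * t)" for t
    unfolding F_def mehler_pairing_def using mehler_mehler[OF \<psi> _ r(1), of t]
    by (auto simp: indicator_def add.commute)
  note \<psi>r = gaussian_bounded_mehler[OF \<psi> r(1)]
  have "(LINT t|lborel. indicator {r<..} t *\<^sub>R F t) = 0"
    using integral_mehler_pairing[OF \<psi>r p f fp null] unfolding F'
    by (subst lborel_integral_real_affine[where c = 1 and t = r]) auto
  moreover have intr: "integrable lborel (\<lambda>t. indicator {r<..} t *\<^sub>R F t)"
    using integrable_mehler_pairing[OF \<psi>r p f fp null] unfolding F'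
    by (subst (asm) lborel_integrable_real_affine_iff) auto
  moreover have "indicator {0<..} t *\<^sub>R F t - indicator {r<..} t *\<^sub>R F t = indicator {0<..r} t *\<^sub>R F t" for t
    using r(1) by (auto simp: indicator_def)
  ultimately have int0: "integrable lborel (\<lambda>t. indicator {0<..r} t *\<^sub>R F t)" and I0: "(LINT t|lborel. indicator {0<..r} t *\<^sub>R F t) = 0"
    using Bochner_Integration.integrable_diff[OF int intr] Bochner_Integration.integral_diff[OF int intr] I by simp_all
  have iL: "integrable lborel (\<lambda>t. indicator {0<..r} t *\<^sub>R x)" for x :: "'b::euclidean_space"
    using r(1) by (intro integrable_scaleR_left integrable_real_indicator) simp_all
  have "r *\<^sub>R L = (LINT t|lborel. indicator {0<..r} t *\<^sub>R L)"
    using r(1) by simp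
  also have "\<dots> = (LINT t|lborel. indicator {0<..r} t *\<^sub>R L - indicator {0<..r} t *\<^sub>R F t)"
    using Bochner_Integration.integral_diff[OF iL int0] I0 by simp
  also have "norm \<dots> \<le> (LINT t|lborel. indicator {0<..r} t *\<^sub>R (norm L / 2))"
  proof (rule order_trans[OF integral_norm_bound integral_mono_AE])
    \<comment> \<open>The estimate holds for t < r only, so the endpoint \<open>r\<close> is
      discarded as a null set.\<close>
    show "AE t in lborel. norm (indicator {0<..r} t *\<^sub>R L - indicator {0<..r} t *\<^sub>R F t) \<le> indicator {0<..r} t *\<^sub>R (norm L / 2)"
      using AE_lborel_singleton[of r]
      by eventually_elim (use r(2) in \<open>auto simp: indicator_def dist_norm norm_minus_commute less_imp_le\<close>)
  qed (intro iL integrable_norm Bochner_Integration.integrable_diff int0)+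
  also have "\<dots> = r * (norm L / 2)" using r(1) by simp
  finally show False using r(1) L by simp
qed

section \<open>Functions with vanishing integrals over boxes\<close>

text \<open>The measures with densities the positive and the negative part of \<open>f\<close> agree
  on boxes, which form an intersection-stable generator with an exhausting sequence of finite
  measure. So the measures agree, and the two parts coincide almost everywhere; this forces both to
  be 0.\<close>

lemma AE_eq_0_if_integral_box_eq_0_real:
  fixes f :: "'a::euclidean_space \<Rightarrow> real"
  assumes [measurable]: "f \<in> borel_measurable lborel"
    and int: "\<And>u v. integrable lborel (\<lambda>x. indicator (box u v) x * f x)"
    and null: "\<And>u v. (LINT x|lborel. indicator (box u v) x * f x) = 0"
  shows "AE x in lborel. f x = 0"
proof -
  have em: "emeasure (density lborel (\<lambda>x. ennreal (g x))) (box u v) = ennreal (LINT x|lborel. indicator (box u v) x * g x)"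
      "integrable lborel (\<lambda>x. indicator (box u v) x * g x)"
    if g: "g = (\<lambda>x. max 0 (f x)) \<or> g = (\<lambda>x. max 0 (- f x))" for g and u v :: 'a
  proof -
    have [measurable]: "g \<in> borel_measurable lborel" using g by auto
    have g0: "g x \<ge> 0" for x using g by auto
    show int': "integrable lborel (\<lambda>x. indicator (box u v) x * g x)"
      using int[of u v] g by (rule_tac Bochner_Integration.integrable_bound) (auto intro!: AE_I2 simp: indicator_def)
    have "emeasure (density lborel (\<lambda>x. ennreal (g x))) (box u v) = (\<integral>\<^sup>+x. ennreal (indicator (box u v) x * g x) \<partial>lborel)"
      using g0 by (simp add: emeasure_density ennreal_mult' ennreal_indicator mult.commute)
    then show "emeasure (density lborel (\<lambda>x. ennreal (g x))) (box u v) = ennreal (LINT x|lborel. indicator (box u v) x * g x)"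
      using nn_integral_eq_integral[OF int'] g0 by simp
  qed
  have "density lborel (\<lambda>x. ennreal (max 0 (f x))) = density lborel (\<lambda>x. ennreal (max 0 (- f x)))"
  proof (rule measure_eqI_generator_eq)
    let ?E = "range (\<lambda>(a, b). box a b::'a set)"
    let ?A = "\<lambda>n::nat. box (- (real n *\<^sub>R One)) (real n *\<^sub>R One) :: 'a set"
    show "Int_stable ?E" by (auto simp: Int_stable_def box_Int_box)
    show "?E \<subseteq> Pow UNIV" "sets (density lborel (\<lambda>x. ennreal (max 0 (f x)))) = sigma_sets UNIV ?E"
      "sets (density lborel (\<lambda>x. ennreal (max 0 (- f x)))) = sigma_sets UNIV ?E"
      by (simp_all add: borel_eq_box)
    show "range ?A \<subseteq> ?E" "(\<Union>i. ?A i) = UNIV" unfolding UN_box_eq_UNIV by auto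
    show "emeasure (density lborel (\<lambda>x. ennreal (max 0 (f x)))) (?A i) \<noteq> \<infinity>" for i
      by (subst em) auto
    show "emeasure (density lborel (\<lambda>x. ennreal (max 0 (f x)))) X = emeasure (density lborel (\<lambda>x. ennreal (max 0 (- f x)))) X"
      if X: "X \<in> ?E" for X
    proof -
      obtain u v where X: "X = box u v" using X by auto
      have "(LINT x|lborel. indicator (box u v) x * max 0 (f x)) - (LINT x|lborel. indicator (box u v) x * max 0 (- f x)) =
          (LINT x|lborel. indicator (box u v) x * max 0 (f x) - indicator (box u v) x * max 0 (- f x))"
        by (intro Bochner_Integration.integral_diff[symmetric] em) auto
      also have "\<dots> = (LINT x|lborel. indicator (box u v) x * f x)"
        by (intro Bochner_Integration.integral_cong) (auto simp: indicator_def)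
      finally show ?thesis by (simp add: X em null)
    qed
  qed
  then have "AE x in lborel. ennreal (max 0 (f x)) = ennreal (max 0 (- f x))"
    by (intro sigma_finite_measure.density_unique[OF sigma_finite_lborel]) auto
  then show ?thesis
    by eventually_elim (auto simp: max_def split: if_splits)
qed

lemma AE_eq_0_if_integral_box_eq_0:
  fixes f :: "'a::euclidean_space \<Rightarrow> 'k::euclidean_space"
  assumes [measurable]: "f \<in> borel_measurable lborel"
    and int: "\<And>u v. integrable lborel (\<lambda>x. indicator (box u v) x *\<^sub>R f x)"
    and null: "\<And>u v. (LINT x|lborel. indicator (box u v) x *\<^sub>R f x) = 0"
  shows "AE x in lborel. f x = 0"
proof -
  have "AE x in lborel. \<forall>b\<in>Basis. f x \<bullet> b = 0"
  proof (intro AE_finite_allI finite_Basis AE_eq_0_if_integral_box_eq_0_real)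
    fix b :: 'k and u v :: 'a
    show "integrable lborel (\<lambda>x. indicator (box u v) x * (f x \<bullet> b))"
      using integrable_inner_left[OF int[of u v], of b] by simp
    show "(LINT x|lborel. indicator (box u v) x * (f x \<bullet> b)) = 0"
      using integral_inner_left[of b lborel "\<lambda>x. indicator (box u v) x *\<^sub>R f x"] int null by simp
  qed measurable
  then show ?thesis by eventually_elim (simp add: euclidean_all_zero_iff)
qed

lemma AE_eq_0_if_potential_one_eq_0:
  fixes f :: "'a::euclidean_space \<Rightarrow> 'k::euclidean_space"
  assumes p: "p \<ge> 1" and f [measurable]: "f \<in> borel_measurable lborel"
    and fp: "integrable lborel (\<lambda>x. norm (f x) powr p)"
    and null: "AE x in lborel. potential 1 f x = 0"
  shows "AE x in lborel. f x = 0"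
proof (rule AE_eq_0_if_integral_box_eq_0[OF f])
  fix u v :: 'a
  obtain c where "gaussian_bounded c (indicator (box u v) :: 'a \<Rightarrow> real)" 
    using gaussian_bounded_indicator_box by blast
  then show "integrable lborel (\<lambda>x. indicator (box u v) x *\<^sub>R f x)"
    by (rule integrable_gaussian_bounded_scaleR(1)[OF _ f integrable_ground_state_scaleR[OF f p fp]])
  show "(LINT x|lborel. indicator (box u v) x *\<^sub>R f x) = 0"
    by (rule integral_box_eq_0[OF p f fp null])
qed

text \<open>Applying a further power to H^(-s) f = 0 reaches an integer exponent, from which factors
  H^(-1) are removed one at a time.\<close>

lemma AE_eq_0_if_potential_eq_0:
  fixes f :: "'a::euclidean_space \<Rightarrow> 'k::euclidean_space"
  assumes s: "s > 0" and p: "p \<ge> 1" and f [measurable]: "f \<in> borel_measurable lborel"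
    and fp: "integrable lborel (\<lambda>x. norm (f x) powr p)"
    and null: "AE x in lborel. potential s f x = 0"
  shows "AE x in lborel. f x = 0"
proof -
  have pow: "AE x in lborel. f x = 0" if "AE x in lborel. potential (real (Suc n)) f x = 0" for n
    using that
  proof (induction n)
    case 0
    then show ?case by (intro AE_eq_0_if_potential_one_eq_0[OF p f fp]) simp
  next
    case (Suc n)
    have n: "real (Suc n) > 0" by simp
    have "AE x in lborel. potential 1 (potential (real (Suc n)) f) x = 0"
      using AE_potential_potential[OF zero_less_one n p f fp] Suc.prems
      by eventually_elim (simp add: add.commute)
    then have "AE x in lborel. potential (real (Suc n)) f x = 0"
      by (intro AE_eq_0_if_potential_one_eq_0[OF p _ integrable_potential_powr[OF n p f fp]]) auto
    then show ?case by (rule Suc.IH)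
  qed
  \<comment> \<open>Using \<open>Suc n\<close> keeps the exponent \<open>real (Suc n) - s\<close>
    strictly positive even when \<open>s\<close> is an integer.\<close>
  define n where "n = nat \<lceil>s\<rceil>"
  have n: "real (Suc n) - s > 0" unfolding n_def using s by linarith
  have "potential (real (Suc n) - s) (potential s f) x = (0::'k)" for x
    unfolding potential_def[of "real (Suc n) - s"] using null
    by (intro integral_eq_zero_AE, eventually_elim) simp
  then have "AE x in lborel. potential (real (Suc n)) f x = 0"
    using AE_potential_potential[OF n s p f fp] by simp
  then show ?thesis by (rule pow)
qed

subsection \<open>Hermite potential spaces\<close>

text \<open>A transfer rule phrased with \<open>potential\<close>, so that transferred goals match
  the results on functions.\<close>

lemma hermite_power_transfer:
  "rel_fun (=) (rel_fun (pcr_ae_fun (=) (=)) (pcr_ae_fun (=) (=))) potential hermite_power"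
  using hermite_power.transfer unfolding potential_def .

lemma ae_rel_refl_iff: "ae_rel f f \<longleftrightarrow> f \<in> borel_measurable lborel"
  by (simp add: ae_rel_def)

lemma powr_norm_add_le:
  fixes x y :: "'a::real_normed_vector"
  assumes "p \<ge> 1"
  shows "norm (x + y) powr p \<le> 2 powr p * (norm x powr p + norm y powr p)"
proof -
  have "norm (x + y) powr p \<le> (2 * max (norm x) (norm y)) powr p"
    using assms by (intro powr_mono2) (auto intro: order_trans[OF norm_triangle_ineq])
  also have "\<dots> \<le> 2 powr p * (norm x powr p + norm y powr p)"
    unfolding powr_mult by (intro mult_left_mono) (auto simp: max_def)
  finally show ?thesis .
qed

lemma Lp_scale: "f \<in> Lp p \<Longrightarrow> scale_ae c f \<in> Lp p"
  unfolding Lp_def mem_Collect_eq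
  by (transfer fixing: p) (simp add: norm_mult powr_mult)

lemma scale_ae_minus_one: "scale_ae (- 1) f = - f"
  by transfer (simp add: ae_rel_def)

text \<open>The factor leaves the Bochner integral even where that diverges, both sides then being
  0, so the identity holds on all classes.\<close>

lemma hermite_power_scale: "hermite_power s (scale_ae c f) = scale_ae c (hermite_power s f)"
proof -
  note [transfer_rule] = hermite_power_transfer
  show ?thesis
  proof (transfer fixing: s, goal_cases)
    case (1 c f)
    then have [measurable]: "f \<in> borel_measurable lborel" by (simp_all add: ae_rel_refl_iff)
    have "potential s (\<lambda>x. c * f x) x = c * potential s f x" for x
      by (simp only: potential_def mult_scaleR_right[symmetric] integral_mult_right_zero)
    then show ?case unfolding ae_rel_def by simp
  qed
qed

section \<open>The operators on \<open>Lp\<close> classes\<close>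

context
  fixes p :: real
  assumes p: "p \<ge> 1"
begin

lemma Lp_add:
  assumes "f \<in> Lp p" "g \<in> Lp p"
  shows "f + g \<in> Lp p"
proof -
  have "in_Lp p f \<Longrightarrow> in_Lp p g \<Longrightarrow> in_Lp p (f + g)"
  proof (transfer fixing: p, goal_cases)
    case (1 f g)
    then have [measurable]: "f \<in> borel_measurable lborel" "g \<in> borel_measurable lborel"
      by (simp_all add: ae_rel_refl_iff)
    show ?case
    proof (rule Bochner_Integration.integrable_bound)
      show "integrable lborel (\<lambda>x. 2 powr p * (norm (f x) powr p + norm (g x) powr p))"
        using 1 by auto
      show "AE x in lborel. norm (norm (f x + g x) powr p) \<le> norm (2 powr p * (norm (f x) powr p + norm (g x) powr p))"
        using powr_norm_add_le[OF p] by (intro AE_I2) (simp add: abs_of_nonneg)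
    qed measurable
  qed
  then show ?thesis using assms by (simp add: Lp_def)
qed

lemma Lp_diff: "f \<in> Lp p \<Longrightarrow> g \<in> Lp p \<Longrightarrow> f - g \<in> Lp p"
  using Lp_add[of f "scale_ae (- 1) g"] Lp_scale[of g p "- 1"] by (simp add: scale_ae_minus_one)

lemma hermite_power_in_Lp:
  assumes s: "s > 0" and f: "f \<in> Lp p"
  shows "hermite_power s f \<in> Lp p" and "Lp_norm p (hermite_power s f) \<le> 4 * Lp_norm p f"
proof -
  note [transfer_rule] = hermite_power_transfer
  have "in_Lp p f \<Longrightarrow> in_Lp p (hermite_power s f)"
    by (transfer fixing: p s) (simp add: ae_rel_refl_iff integrable_potential_powr[OF s p])
  then show "hermite_power s f \<in> Lp p" using f by (simp add: Lp_def)
  have "in_Lp p f \<Longrightarrow> Lp_norm p (hermite_power s f) \<le> 4 * Lp_norm p f"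
  proof (transfer fixing: p s, goal_cases)
    case (1 f)
    then have f: "f \<in> borel_measurable lborel" by (simp add: ae_rel_refl_iff)
    have "(LINT x|lborel. norm (potential s f x) powr p) powr (1 / p) \<le>
        (4 powr p * (LINT x|lborel. norm (f x) powr p)) powr (1 / p)"
      using p by (intro powr_mono2 integral_potential_powr_le[OF s p f 1(2)]) (auto intro!: integral_nonneg_AE)
    also have "\<dots> = 4 * (LINT x|lborel. norm (f x) powr p) powr (1 / p)"
      using p by (simp add: powr_mult powr_powr)
    finally show ?case .
  qed
  then show "Lp_norm p (hermite_power s f) \<le> 4 * Lp_norm p f" using f by (simp add: Lp_def)
qed

text \<open>Additivity of the Bochner integral requires both integrals to converge, which the Schur
  test provides for almost every \<open>x\<close>.\<close>

lemma hermite_power_add: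
  assumes s: "s > 0" and "f \<in> Lp p" "g \<in> Lp p"
  shows "hermite_power s (f + g) = hermite_power s f + hermite_power s g"
proof -
  note [transfer_rule] = hermite_power_transfer
  have "in_Lp p f \<Longrightarrow> in_Lp p g \<Longrightarrow> hermite_power s (f + g) = hermite_power s f + hermite_power s g"
  proof (transfer fixing: p s, goal_cases)
    case (1 f g)
    then have f [measurable]: "f \<in> borel_measurable lborel" and g [measurable]: "g \<in> borel_measurable lborel"
      by (simp_all add: ae_rel_refl_iff)
    have "AE x in lborel. potential s (\<lambda>x. f x + g x) x = potential s f x + potential s g x"
      using AE_integrable_potential[OF s p f] AE_integrable_potential[OF s p g] 1
      by (auto simp: potential_def scaleR_add_right elim: eventually_elim2)
    then show ?case unfolding ae_rel_def by simp
  qed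
  then show ?thesis using assms by (simp add: Lp_def)
qed

lemma hermite_power_diff:
  assumes "s > 0" "f \<in> Lp p" "g \<in> Lp p"
  shows "hermite_power s (f - g) = hermite_power s f - hermite_power s g"
  using hermite_power_add[of s f "scale_ae (- 1) g"] Lp_scale[of g p "- 1"] assms
  unfolding hermite_power_scale by (simp add: scale_ae_minus_one)

lemma hermite_power_hermite_power:
  assumes s: "s > 0" and r: "r > 0" and "f \<in> Lp p"
  shows "hermite_power s (hermite_power r f) = hermite_power (s + r) f"
proof -
  note [transfer_rule] = hermite_power_transfer
  have "in_Lp p f \<Longrightarrow> hermite_power s (hermite_power r f) = hermite_power (s + r) f"
    by (transfer fixing: p s r) (auto simp: ae_rel_def intro!: AE_potential_potential[OF s r p])
  then show ?thesis using assms by (simp add: Lp_def)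
qed

lemma hermite_power_eq_0:
  assumes s: "s > 0" and "f \<in> Lp p" "hermite_power s f = 0"
  shows "f = 0"
proof -
  note [transfer_rule] = hermite_power_transfer
  have "in_Lp p f \<Longrightarrow> hermite_power s f = 0 \<Longrightarrow> f = 0"
  proof (transfer fixing: p s, goal_cases)
    case (1 f)
    then show ?case using AE_eq_0_if_potential_eq_0[OF s p, of f] by (simp add: ae_rel_def)
  qed
  then show ?thesis using assms by (simp add: Lp_def)
qed

lemma inj_on_hermite_power:
  assumes s: "s > 0"
  shows "inj_on (hermite_power s) (Lp p)"
proof (rule inj_onI)
  fix f g
  assume fg: "f \<in> Lp p" "g \<in> Lp p" "hermite_power s f = hermite_power s g"
  then have "hermite_power s (f - g) = 0" by (simp add: hermite_power_diff[OF s])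
  then have "f - g = 0" by (rule hermite_power_eq_0[OF s Lp_diff[OF fg(1,2)]])
  then show "f = g" by simp
qed

text \<open>Continuity is formulated with differences; this presents a difference as the image of
  one \<open>Lp\<close> element, whose norm is then computable.\<close>

lemma hermite_potential_diffE:
  assumes a: "a > 0" and "f \<in> hermite_potential p a" "g \<in> hermite_potential p a"
  obtains h where "h \<in> Lp p" "g - f = hermite_power (a / 2) h"
proof -
  obtain f' g' where fg: "f' \<in> Lp p" "g' \<in> Lp p" "f = hermite_power (a / 2) f'" "g = hermite_power (a / 2) g'"
    using assms unfolding hermite_potential_def by blast
  then have "g - f = hermite_power (a / 2) (g' - f')"
    using a by (simp add: hermite_power_diff)
  then show ?thesis by (rule that[OF Lp_diff[OF fg(2,1)]])
qed

text \<open>Injectivity makes the definite description in the norm pick out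
  \<open>g\<close>.\<close>

lemma hermite_potential_norm_hermite_power:
  assumes a: "a > 0" and g: "g \<in> Lp p"
  shows "hermite_potential_norm p a (hermite_power (a / 2) g) = Lp_norm p g"
proof -
  have "(THE g'. g' \<in> Lp p \<and> hermite_power (a / 2) g' = hermite_power (a / 2) g) = g"
    using inj_on_hermite_power[of "a / 2"] a g by (intro the_equality) (auto dest: inj_onD)
  then show ?thesis by (simp add: hermite_potential_norm_def)
qed

end

section \<open>Inclusions and isometric isomorphism\<close>

text \<open>A linear norm bound gives continuity with \<delta> = \<epsilon> / C.\<close>

lemma continuously_includedI:
  assumes "S \<subseteq> S'" and C: "C > 0"
    and bound: "\<And>f g. f \<in> S \<Longrightarrow> g \<in> S \<Longrightarrow> N' (g - f) \<le> C * N (g - f)"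
  shows "continuously_included S N S' N'"
  unfolding continuously_included_def
proof (intro conjI ballI allI impI assms(1))
  fix f and \<epsilon> :: real
  assume "f \<in> S" "\<epsilon> > 0"
  then show "\<exists>\<delta>>0. \<forall>g\<in>S. N (g - f) < \<delta> \<longrightarrow> N' (g - f) < \<epsilon>"
    using C bound by (intro exI[of _ "\<epsilon> / C"]) (fastforce simp: field_simps)
qed

theorem theorem2:
  fixes p a b :: real
  assumes "1 \<le> p" and "0 < a" and "a < b"
  shows
    "continuously_included
       (hermite_potential p b :: ('a::euclidean_space, 'k::{real_normed_field, euclidean_space}) ae_fun set)
       (hermite_potential_norm p b)
       (hermite_potential p a) (hermite_potential_norm p a) \<and>
     continuously_included
       (hermite_potential p a :: ('a, 'k) ae_fun set) (hermite_potential_norm p a)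
       (Lp p) (Lp_norm p) \<and>
     isometrically_isomorphic
       (hermite_potential p a :: ('a, 'k) ae_fun set) (hermite_potential_norm p a)
       (hermite_potential p b) (hermite_potential_norm p b)"
proof (intro conjI)
  note p = assms(1)
  have a: "a / 2 > 0" and b: "b / 2 > 0" "b > 0" and ba: "b / 2 - a / 2 > 0" using assms by auto
  have ab: "hermite_power (b / 2) g = hermite_power (a / 2) (hermite_power (b / 2 - a / 2) g)"
    if "g \<in> Lp p" for g :: "('a, 'k) ae_fun"
    using hermite_power_hermite_power[OF p a ba that] by simp
  note norm = hermite_potential_norm_hermite_power[OF p]
  note Lp = hermite_power_in_Lp[OF p]
  show "continuously_included
       (hermite_potential p b :: ('a, 'k) ae_fun set) (hermite_potential_norm p b)
       (hermite_potential p a) (hermite_potential_norm p a)"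
  proof (rule continuously_includedI[where C = 4])
    show "(hermite_potential p b :: ('a, 'k) ae_fun set) \<subseteq> hermite_potential p a"
      unfolding hermite_potential_def using ab Lp(1)[OF ba] by blast
    show "(4 :: real) > 0" by simp
    fix f g :: "('a, 'k) ae_fun"
    assume fg: "f \<in> hermite_potential p b" "g \<in> hermite_potential p b"
    obtain h where h: "h \<in> Lp p" "g - f = hermite_power (b / 2) h"
      by (rule hermite_potential_diffE[OF p b(2) fg])
    show "hermite_potential_norm p a (g - f) \<le> 4 * hermite_potential_norm p b (g - f)"
      unfolding h norm[OF b(2) h(1)] unfolding ab[OF h(1)] norm[OF assms(2) Lp(1)[OF ba h(1)]]
      by (rule Lp(2)[OF ba h(1)])
  qed
  show "continuously_included
       (hermite_potential p a :: ('a, 'k) ae_fun set) (hermite_potential_norm p a) (Lp p) (Lp_norm p)"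
  proof (rule continuously_includedI[where C = 4])
    show "(hermite_potential p a :: ('a, 'k) ae_fun set) \<subseteq> Lp p"
      unfolding hermite_potential_def using Lp(1)[OF a] by blast
    show "(4 :: real) > 0" by simp
    fix f g :: "('a, 'k) ae_fun"
    assume fg: "f \<in> hermite_potential p a" "g \<in> hermite_potential p a"
    obtain h where h: "h \<in> Lp p" "g - f = hermite_power (a / 2) h"
      by (rule hermite_potential_diffE[OF p assms(2) fg])
    show "Lp_norm p (g - f) \<le> 4 * hermite_potential_norm p a (g - f)"
      unfolding h norm[OF assms(2) h(1)] by (rule Lp(2)[OF a h(1)])
  qed
  show "isometrically_isomorphic
       (hermite_potential p a :: ('a, 'k) ae_fun set) (hermite_potential_norm p a)
       (hermite_potential p b) (hermite_potential_norm p b)"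
  proof -
    define R where "R = the_inv_into (Lp p :: ('a, 'k) ae_fun set) (hermite_power (a / 2))"
    define T where "T = hermite_power (b / 2) \<circ> R"
    note inj = inj_on_hermite_power[OF p]
    have R: "R (hermite_power (a / 2) g) = g" if "g \<in> Lp p" for g
      unfolding R_def by (rule the_inv_into_f_f[OF inj[OF a] that])
    have "bij_betw R (hermite_potential p a) (Lp p)"
      unfolding R_def hermite_potential_def
      by (intro bij_betw_the_inv_into inj_on_imp_bij_betw inj[OF a])
    moreover have "bij_betw (hermite_power (b / 2)) (Lp p :: ('a, 'k) ae_fun set) (hermite_potential p b)"
      unfolding hermite_potential_def by (intro inj_on_imp_bij_betw inj[OF b(1)])
    ultimately have "bij_betw T (hermite_potential p a) (hermite_potential p b)"
      unfolding T_def by (rule bij_betw_trans)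
    \<comment> \<open>A sum of images under H^(-a/2) is first rewritten as the image of a sum, to
      which the inverse \<open>R\<close> applies.\<close>
    moreover have "T (f + g) = T f + T g" if "f \<in> hermite_potential p a" "g \<in> hermite_potential p a" for f g
      using that unfolding hermite_potential_def T_def
      by (auto simp: R Lp_add[OF p] hermite_power_add[OF p b(1)] simp flip: hermite_power_add[OF p a])
    moreover have "T (scale_ae c f) = scale_ae c (T f)" if "f \<in> hermite_potential p a" for c f
      using that unfolding hermite_potential_def T_def
      by (auto simp: R Lp_scale simp flip: hermite_power_scale)
    moreover have "hermite_potential_norm p b (T f) = hermite_potential_norm p a f" if "f \<in> hermite_potential p a" for f
      using that unfolding hermite_potential_def T_def by (auto simp: R norm b(2) assms(2))
    ultimately show ?thesis unfolding isometrically_isomorphic_def by blast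
  qed
qed

end
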